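(* Let $(Q,L_d,f_d)$ be a forced discrete mechanical system of Routh type with potential $\beta\in\Omega^2(Q)$, and let $\mathbf F_{L_d,f_d}:U\to V$ be a forced discrete flow of it. Then the 2-form $$\omega^+ := (\mathbb F^+_{f_d}L_d)^*(\omega_Q-\pi_Q^*\beta)$$ on $Q\times Q$ is preserved by the flow, i.e. $(\mathbf F_{L_d,f_d})^*\omega^+=\omega^+$ on $U$.
   Context: $Q$ is a smooth $n$-dimensional manifold; $\mathrm{pr}_1,\mathrm{pr}_2:Q\times Q\to Q$ are the projections. For a smooth $H$ on $Q\times Q$, $D_1H(q_0,q_1)(\delta q_0):=TH(\delta q_0,0)$ and $D_2H(q_0,q_1)(\delta q_1):=TH(0,\delta q_1)$. A forced discrete mechanical system (FDMS) is a triple $(Q,L_d,f_d)$ with $L_d:Q\times Q\to\mathbb R$ smooth and $f_d$ a (smooth) 1-form on $Q\times Q$, written $f_d(q_0,q_1)(\delta q_0,\delta q_1)=f_d^-(q_0,q_1)(\delta q_0)+f_d^+(q_0,q_1)(\delta q_1)$ with $f_d^-(q_0,q_1)\in T^*_{q_0}Q$, $f_d^+(q_0,q_1)\in T^*_{q_1}Q$. A triple $(q_0,q_1,q_2)$ is a trajectory iff $D_2L_d(q_0,q_1)+D_1L_d(q_1,q_2)+f_d^+(q_0,q_1)+f_d^-(q_1,q_2)=0\in T^*_{q_1}Q$. A forced discrete flow is a diffeomorphism $\mathbf F_{L_d,f_d}:U\to V$ between open subsets of $Q\times Q$ such that for every $(q_0,q_1)\in U$ one has $\mathbf F_{L_d,f_d}(q_0,q_1)=(q_1,q_2)$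 with $(q_0,q_1,q_2)$ a trajectory, and every trajectory $(q_0',q_1',q_2')$ with $(q_0',q_1')\in U$, $(q_1',q_2')\in V$ satisfies $\mathbf F_{L_d,f_d}(q_0',q_1')=(q_1',q_2')$. The forced discrete Legendre transform is $\mathbb F^+_{f_d}L_d:Q\times Q\to T^*Q$, $\mathbb F^+_{f_d}L_d(q_0,q_1):=(q_1,D_2L_d(q_0,q_1)+f_d^+(q_0,q_1))$. $\pi_Q:T^*Q\to Q$ is the projection, $\theta_Q$ the canonical 1-form and $\omega_Q=-d\theta_Q$ the canonical symplectic form. The system is of Routh type with (Routh) potential $\beta\in\Omega^2(Q)$ if $-df_d=\mathrm{pr}_2^*\beta-\mathrm{pr}_1^*\beta$. *)

theory Defs
  imports "HOL-Analysis.Analysis"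
begin

section \<open>Smooth maps between open subsets of Euclidean spaces\<close>

fun differentiable_upto ::
    "nat \<Rightarrow> 'a::euclidean_space set \<Rightarrow> ('a \<Rightarrow> 'b::real_normed_vector) \<Rightarrow> bool" where
  "differentiable_upto 0 S f \<longleftrightarrow> continuous_on S f"
| "differentiable_upto (Suc k) S f \<longleftrightarrow>
     (\<forall>x\<in>S. f differentiable (at x)) \<and>
     (\<forall>v. differentiable_upto k S (\<lambda>x. frechet_derivative f (at x) v))"

text \<open>Only used for open sets; there it is the usual class of \<open>C\<^sup>\<infinity>\<close> maps
  (all iterated directional derivatives exist and are continuous).\<close>

definition smooth_on :: "'a::euclidean_space set \<Rightarrow> ('a \<Rightarrow> 'b::real_normed_vector) \<Rightarrow> bool" where
  "smooth_on S f \<longleftrightarrow> (\<forall>k. differentiable_upto k S f)"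


section \<open>Smooth manifolds\<close>

text \<open>A chart is a pair of a domain and a coordinate map. The coordinate map is a total function,
  but only its values on the domain are relevant. A manifold is given by its atlas; the underlying
  set is the union of the chart domains, and the topology is the one induced by the charts.\<close>

type_synonym ('m, 'e) chart = "'m set \<times> ('m \<Rightarrow> 'e)"
type_synonym ('m, 'e) atlas = "('m, 'e) chart set"

abbreviation chart_dom :: "('m, 'e) chart \<Rightarrow> 'm set" where
  "chart_dom c \<equiv> fst c"

abbreviation chart_map :: "('m, 'e) chart \<Rightarrow> 'm \<Rightarrow> 'e" where
  "chart_map c \<equiv> snd c"

abbreviation chart_inv :: "('m, 'e) chart \<Rightarrow> 'e \<Rightarrow> 'm" where
  "chart_inv c \<equiv> inv_into (chart_dom c) (chart_map c)"

definition points :: "('m, 'e) atlas \<Rightarrow> 'm set" where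
  "points A = (\<Union>c\<in>A. chart_dom c)"

definition smooth_atlas :: "('m, 'e::euclidean_space) atlas \<Rightarrow> bool" where
  "smooth_atlas A \<longleftrightarrow>
     (\<forall>c\<in>A. inj_on (chart_map c) (chart_dom c)) \<and>
     (\<forall>c\<in>A. \<forall>d\<in>A.
        open (chart_map c ` (chart_dom c \<inter> chart_dom d)) \<and>
        smooth_on (chart_map c ` (chart_dom c \<inter> chart_dom d)) (chart_map d \<circ> chart_inv c))"

definition atlas_open :: "('m, 'e::euclidean_space) atlas \<Rightarrow> 'm set \<Rightarrow> bool" where
  "atlas_open A W \<longleftrightarrow> W \<subseteq> points A \<and> (\<forall>c\<in>A. open (chart_map c ` (chart_dom c \<inter> W)))"

definition atlas_topology :: "('m, 'e::euclidean_space) atlas \<Rightarrow> 'm topology" where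
  "atlas_topology A = topology (atlas_open A)"

lemma openin_atlas_topology:
  assumes "smooth_atlas A"
  shows "openin (atlas_topology A) W \<longleftrightarrow> atlas_open A W"
proof -
  have "istopology (atlas_open A)"
    unfolding istopology_def
  proof safe
    fix S T assume ST: "atlas_open A S" "atlas_open A T"
    show "atlas_open A (S \<inter> T)"
      unfolding atlas_open_def
    proof (intro conjI ballI)
      show "S \<inter> T \<subseteq> points A" using ST unfolding atlas_open_def by blast
      fix c assume c: "c \<in> A"
      have inj: "inj_on (chart_map c) (chart_dom c)"
        using assms c unfolding smooth_atlas_def by blast
      have "chart_map c ` (chart_dom c \<inter> (S \<inter> T)) =
          chart_map c ` (chart_dom c \<inter> S) \<inter> chart_map c ` (chart_dom c \<inter> T)"
        using inj unfolding inj_on_def by blast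
      then show "open (chart_map c ` (chart_dom c \<inter> (S \<inter> T)))"
        using ST c unfolding atlas_open_def by auto
    qed
  next
    fix K assume K: "\<forall>S\<in>K. atlas_open A S"
    show "atlas_open A (\<Union>K)"
      unfolding atlas_open_def
    proof (intro conjI ballI)
      show "\<Union>K \<subseteq> points A" using K unfolding atlas_open_def by blast
      fix c assume "c \<in> A"
      then have "open (\<Union>S\<in>K. chart_map c ` (chart_dom c \<inter> S))"
        using K unfolding atlas_open_def by blast
      moreover have "chart_map c ` (chart_dom c \<inter> \<Union>K) =
          (\<Union>S\<in>K. chart_map c ` (chart_dom c \<inter> S))" by blast
      ultimately show "open (chart_map c ` (chart_dom c \<inter> \<Union>K))" by simp
    qed
  qed
  then show ?thesis by (simp add: atlas_topology_def)
qed

definition smooth_manifold :: "('m, 'e::euclidean_space) atlas \<Rightarrow> bool" where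
  "smooth_manifold A \<longleftrightarrow>
     smooth_atlas A \<and> Hausdorff_space (atlas_topology A) \<and> second_countable (atlas_topology A)"

definition prod_atlas :: "('m, 'e) atlas \<Rightarrow> ('n, 'f) atlas \<Rightarrow> ('m \<times> 'n, 'e \<times> 'f) atlas" where
  "prod_atlas A B =
     {(chart_dom c \<times> chart_dom d, map_prod (chart_map c) (chart_map d)) | c d. c \<in> A \<and> d \<in> B}"

text \<open>The first condition on the coordinate expressions below (openness of their domains) amounts
  to continuity of the map.\<close>

definition smooth_map_on ::
    "('m, 'e::euclidean_space) atlas \<Rightarrow> ('n, 'f::euclidean_space) atlas \<Rightarrow> 'm set \<Rightarrow> ('m \<Rightarrow> 'n) \<Rightarrow> bool"
where
  "smooth_map_on A B W f \<longleftrightarrow>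
     f ` W \<subseteq> points B \<and>
     (\<forall>c\<in>A. \<forall>d\<in>B. let S = chart_map c ` {p \<in> chart_dom c \<inter> W. f p \<in> chart_dom d} in
        open S \<and> smooth_on S (chart_map d \<circ> f \<circ> chart_inv c))"

definition smooth_function :: "('m, 'e::euclidean_space) atlas \<Rightarrow> ('m \<Rightarrow> real) \<Rightarrow> bool" where
  "smooth_function A g \<longleftrightarrow>
     (\<forall>c\<in>A. smooth_on (chart_map c ` chart_dom c) (g \<circ> chart_inv c))"

definition diffeomorphism_between ::
    "('m, 'e::euclidean_space) atlas \<Rightarrow> 'm set \<Rightarrow> 'm set \<Rightarrow> ('m \<Rightarrow> 'm) \<Rightarrow> bool" where
  "diffeomorphism_between A U V F \<longleftrightarrow>
     bij_betw F U V \<and> smooth_map_on A A U F \<and> smooth_map_on A A V (inv_into U F)"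


section \<open>Tangent vectors\<close>

text \<open>A tangent vector at \<open>p\<close> is the family of its coordinate representations, one for each chart
  around \<open>p\<close>, related by the derivatives of the coordinate changes (and \<open>0\<close> at all other
  indices). The vector space operations are pointwise.\<close>

type_synonym ('m, 'e) tvec = "('m, 'e) chart \<Rightarrow> 'e"

definition tangent_space :: "('m, 'e::euclidean_space) atlas \<Rightarrow> 'm \<Rightarrow> ('m, 'e) tvec set" where
  "tangent_space A p =
     {v. (\<forall>c. c \<notin> A \<or> p \<notin> chart_dom c \<longrightarrow> v c = 0) \<and>
         (\<forall>c\<in>A. \<forall>d\<in>A. p \<in> chart_dom c \<inter> chart_dom d \<longrightarrow>
            v d = frechet_derivative (chart_map d \<circ> chart_inv c) (at (chart_map c p)) (v c))}"

definition tzero :: "('m, 'e::euclidean_space) tvec" where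
  "tzero = (\<lambda>c. 0)"

definition tadd :: "('m, 'e::euclidean_space) tvec \<Rightarrow> ('m, 'e) tvec \<Rightarrow> ('m, 'e) tvec" where
  "tadd v w = (\<lambda>c. v c + w c)"

definition tscale :: "real \<Rightarrow> ('m, 'e::euclidean_space) tvec \<Rightarrow> ('m, 'e) tvec" where
  "tscale r v = (\<lambda>c. r *\<^sub>R v c)"

definition chart_at :: "('m, 'e) atlas \<Rightarrow> 'm \<Rightarrow> ('m, 'e) chart" where
  "chart_at A p = (SOME c. c \<in> A \<and> p \<in> chart_dom c)"

text \<open>The tangent vector at \<open>p\<close> whose representation in the chart \<open>c\<close> is \<open>u\<close>.\<close>

definition coord_vec ::
    "('m, 'e::euclidean_space) atlas \<Rightarrow> ('m, 'e) chart \<Rightarrow> 'm \<Rightarrow> 'e \<Rightarrow> ('m, 'e) tvec" where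
  "coord_vec A c p u = (\<lambda>d. if d \<in> A \<and> p \<in> chart_dom d
     then frechet_derivative (chart_map d \<circ> chart_inv c) (at (chart_map c p)) u else 0)"

text \<open>The tangent map \<open>T\<^sub>p f\<close>. It only depends on the germ of \<open>f\<close> at \<open>p\<close>.\<close>

definition tangent_map ::
    "('m, 'e::euclidean_space) atlas \<Rightarrow> ('n, 'f::euclidean_space) atlas \<Rightarrow> ('m \<Rightarrow> 'n) \<Rightarrow> 'm
      \<Rightarrow> ('m, 'e) tvec \<Rightarrow> ('n, 'f) tvec" where
  "tangent_map A B f p v = (let c = chart_at A p in
     (\<lambda>d. if d \<in> B \<and> f p \<in> chart_dom d
        then frechet_derivative (chart_map d \<circ> f \<circ> chart_inv c) (at (chart_map c p)) (v c) else 0))"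

text \<open>The tangent map of a real-valued function, with the tangent spaces of the real line
  identified with the real line.\<close>

definition differential ::
    "('m, 'e::euclidean_space) atlas \<Rightarrow> ('m \<Rightarrow> real) \<Rightarrow> 'm \<Rightarrow> ('m, 'e) tvec \<Rightarrow> real" where
  "differential A H p v = (let c = chart_at A p in
     frechet_derivative (H \<circ> chart_inv c) (at (chart_map c p)) (v c))"

text \<open>The identification of \<open>T\<^sub>p M \<times> T\<^sub>q N\<close> with the tangent space of \<open>M \<times> N\<close> at \<open>(p, q)\<close>.\<close>

definition tpair ::
    "('m, 'e::euclidean_space) atlas \<Rightarrow> ('n, 'f::euclidean_space) atlas \<Rightarrow> 'm \<Rightarrow> 'n
      \<Rightarrow> ('m, 'e) tvec \<Rightarrow> ('n, 'f) tvec \<Rightarrow> ('m \<times> 'n, 'e \<times> 'f) tvec" where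
  "tpair A B p q v w = (THE u. u \<in> tangent_space (prod_atlas A B) (p, q) \<and>
     tangent_map (prod_atlas A B) A fst (p, q) u = v \<and>
     tangent_map (prod_atlas A B) B snd (p, q) u = w)"


section \<open>Differential forms of degree one and two\<close>

text \<open>Only the values of a form on tangent vectors at points of the manifold are relevant.\<close>

type_synonym ('m, 'e) form1 = "'m \<Rightarrow> ('m, 'e) tvec \<Rightarrow> real"
type_synonym ('m, 'e) form2 = "'m \<Rightarrow> ('m, 'e) tvec \<Rightarrow> ('m, 'e) tvec \<Rightarrow> real"

definition linear_on_tangent ::
    "('m, 'e::euclidean_space) atlas \<Rightarrow> 'm \<Rightarrow> (('m, 'e) tvec \<Rightarrow> real) \<Rightarrow> bool" where
  "linear_on_tangent A p \<alpha> \<longleftrightarrow>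
     (\<forall>v\<in>tangent_space A p. \<forall>w\<in>tangent_space A p. \<alpha> (tadd v w) = \<alpha> v + \<alpha> w) \<and>
     (\<forall>r. \<forall>v\<in>tangent_space A p. \<alpha> (tscale r v) = r * \<alpha> v)"

definition smooth_form1 :: "('m, 'e::euclidean_space) atlas \<Rightarrow> ('m, 'e) form1 \<Rightarrow> bool" where
  "smooth_form1 A \<alpha> \<longleftrightarrow>
     (\<forall>p\<in>points A. linear_on_tangent A p (\<alpha> p)) \<and>
     (\<forall>c\<in>A. \<forall>u. smooth_on (chart_map c ` chart_dom c)
        (\<lambda>x. \<alpha> (chart_inv c x) (coord_vec A c (chart_inv c x) u)))"

definition smooth_form2 :: "('m, 'e::euclidean_space) atlas \<Rightarrow> ('m, 'e) form2 \<Rightarrow> bool" where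
  "smooth_form2 A \<omega> \<longleftrightarrow>
     (\<forall>p\<in>points A.
        (\<forall>v\<in>tangent_space A p. linear_on_tangent A p (\<lambda>w. \<omega> p v w)) \<and>
        (\<forall>w\<in>tangent_space A p. linear_on_tangent A p (\<lambda>v. \<omega> p v w)) \<and>
        (\<forall>v\<in>tangent_space A p. \<omega> p v v = 0)) \<and>
     (\<forall>c\<in>A. \<forall>u u'. smooth_on (chart_map c ` chart_dom c)
        (\<lambda>x. \<omega> (chart_inv c x) (coord_vec A c (chart_inv c x) u) (coord_vec A c (chart_inv c x) u')))"

definition form2_eq_on ::
    "('m, 'e::euclidean_space) atlas \<Rightarrow> 'm set \<Rightarrow> ('m, 'e) form2 \<Rightarrow> ('m, 'e) form2 \<Rightarrow> bool" where
  "form2_eq_on A W \<omega> \<eta> \<longleftrightarrow>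
     (\<forall>p\<in>W. \<forall>v\<in>tangent_space A p. \<forall>w\<in>tangent_space A p. \<omega> p v w = \<eta> p v w)"

definition form2_uminus :: "('m, 'e) form2 \<Rightarrow> ('m, 'e) form2" where
  "form2_uminus \<omega> = (\<lambda>p v w. - \<omega> p v w)"

definition form2_minus :: "('m, 'e) form2 \<Rightarrow> ('m, 'e) form2 \<Rightarrow> ('m, 'e) form2" where
  "form2_minus \<omega> \<eta> = (\<lambda>p v w. \<omega> p v w - \<eta> p v w)"

definition pullback2 ::
    "('m, 'e::euclidean_space) atlas \<Rightarrow> ('n, 'f::euclidean_space) atlas \<Rightarrow> ('m \<Rightarrow> 'n)
      \<Rightarrow> ('n, 'f) form2 \<Rightarrow> ('m, 'e) form2" where
  "pullback2 A B f \<omega> = (\<lambda>p v w. \<omega> (f p) (tangent_map A B f p v) (tangent_map A B f p w))"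

text \<open>The exterior derivative of a 1-form, computed in a chart around the point:
  \<open>d\<alpha>(X, Y) = X(\<alpha>(Y)) - Y(\<alpha>(X)) - \<alpha>([X, Y])\<close> for the vector fields \<open>X\<close>, \<open>Y\<close> with constant
  coordinates in the chart extending the two arguments; their bracket vanishes.\<close>

definition ext_deriv :: "('m, 'e::euclidean_space) atlas \<Rightarrow> ('m, 'e) form1 \<Rightarrow> ('m, 'e) form2" where
  "ext_deriv A \<alpha> = (\<lambda>p v w.
     let c = chart_at A p;
         a = (\<lambda>u x. \<alpha> (chart_inv c x) (coord_vec A c (chart_inv c x) u))
     in frechet_derivative (a (w c)) (at (chart_map c p)) (v c)
        - frechet_derivative (a (v c)) (at (chart_map c p)) (w c))"


section \<open>The cotangent bundle\<close>

text \<open>Covectors are made extensional (\<open>undefined\<close> outside the tangent space), so that a covector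
  is determined by its values on tangent vectors. The chart of the cotangent bundle induced by a
  chart of the base sends \<open>(q, \<alpha>)\<close> to the coordinates of \<open>q\<close> and the vector of the values of \<open>\<alpha>\<close>
  on the coordinate basis.\<close>

type_synonym ('m, 'e) covec = "('m, 'e) tvec \<Rightarrow> real"

definition cotangent_space :: "('m, 'e::euclidean_space) atlas \<Rightarrow> 'm \<Rightarrow> ('m, 'e) covec set" where
  "cotangent_space A q = {\<alpha> \<in> extensional (tangent_space A q). linear_on_tangent A q \<alpha>}"

definition cotangent_chart ::
    "('m, 'e::euclidean_space) atlas \<Rightarrow> ('m, 'e) chart \<Rightarrow> ('m \<times> ('m, 'e) covec, 'e \<times> 'e) chart" where
  "cotangent_chart A c =
     ({(q, \<alpha>). q \<in> chart_dom c \<and> \<alpha> \<in> cotangent_space A q},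
      (\<lambda>(q, \<alpha>). (chart_map c q, \<Sum>b\<in>Basis. \<alpha> (coord_vec A c q b) *\<^sub>R b)))"

definition cotangent_bundle ::
    "('m, 'e::euclidean_space) atlas \<Rightarrow> ('m \<times> ('m, 'e) covec, 'e \<times> 'e) atlas" where
  "cotangent_bundle A = cotangent_chart A ` A"

text \<open>The bundle projection is \<open>fst\<close>.\<close>

definition canonical_form1 ::
    "('m, 'e::euclidean_space) atlas \<Rightarrow> ('m \<times> ('m, 'e) covec, 'e \<times> 'e) form1" where
  "canonical_form1 A = (\<lambda>(q, \<alpha>) \<xi>. \<alpha> (tangent_map (cotangent_bundle A) A fst (q, \<alpha>) \<xi>))"

definition canonical_symplectic ::
    "('m, 'e::euclidean_space) atlas \<Rightarrow> ('m \<times> ('m, 'e) covec, 'e \<times> 'e) form2" where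
  "canonical_symplectic A = form2_uminus (ext_deriv (cotangent_bundle A) (canonical_form1 A))"


section \<open>Forced discrete mechanical systems\<close>

definition forced_discrete_system ::
    "('q, 'e::euclidean_space) atlas \<Rightarrow> ('q \<times> 'q \<Rightarrow> real) \<Rightarrow> ('q \<times> 'q, 'e \<times> 'e) form1 \<Rightarrow> bool" where
  "forced_discrete_system Q L f \<longleftrightarrow>
     smooth_manifold Q \<and> smooth_function (prod_atlas Q Q) L \<and> smooth_form1 (prod_atlas Q Q) f"

definition D1 ::
    "('q, 'e::euclidean_space) atlas \<Rightarrow> ('q \<times> 'q \<Rightarrow> real) \<Rightarrow> 'q \<times> 'q \<Rightarrow> ('q, 'e) tvec \<Rightarrow> real" where
  "D1 Q H = (\<lambda>(q0, q1) v. differential (prod_atlas Q Q) H (q0, q1) (tpair Q Q q0 q1 v tzero))"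

definition D2 ::
    "('q, 'e::euclidean_space) atlas \<Rightarrow> ('q \<times> 'q \<Rightarrow> real) \<Rightarrow> 'q \<times> 'q \<Rightarrow> ('q, 'e) tvec \<Rightarrow> real" where
  "D2 Q H = (\<lambda>(q0, q1) v. differential (prod_atlas Q Q) H (q0, q1) (tpair Q Q q0 q1 tzero v))"

definition force_minus ::
    "('q, 'e::euclidean_space) atlas \<Rightarrow> ('q \<times> 'q, 'e \<times> 'e) form1 \<Rightarrow> 'q \<times> 'q \<Rightarrow> ('q, 'e) tvec \<Rightarrow> real"
where
  "force_minus Q f = (\<lambda>(q0, q1) v. f (q0, q1) (tpair Q Q q0 q1 v tzero))"

definition force_plus ::
    "('q, 'e::euclidean_space) atlas \<Rightarrow> ('q \<times> 'q, 'e \<times> 'e) form1 \<Rightarrow> 'q \<times> 'q \<Rightarrow> ('q, 'e) tvec \<Rightarrow> real"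
where
  "force_plus Q f = (\<lambda>(q0, q1) v. f (q0, q1) (tpair Q Q q0 q1 tzero v))"

definition trajectory ::
    "('q, 'e::euclidean_space) atlas \<Rightarrow> ('q \<times> 'q \<Rightarrow> real) \<Rightarrow> ('q \<times> 'q, 'e \<times> 'e) form1
      \<Rightarrow> 'q \<Rightarrow> 'q \<Rightarrow> 'q \<Rightarrow> bool" where
  "trajectory Q L f q0 q1 q2 \<longleftrightarrow>
     q0 \<in> points Q \<and> q1 \<in> points Q \<and> q2 \<in> points Q \<and>
     (\<forall>v\<in>tangent_space Q q1.
        D2 Q L (q0, q1) v + D1 Q L (q1, q2) v
        + force_plus Q f (q0, q1) v + force_minus Q f (q1, q2) v = 0)"

definition forced_discrete_flow ::
    "('q, 'e::euclidean_space) atlas \<Rightarrow> ('q \<times> 'q \<Rightarrow> real) \<Rightarrow> ('q \<times> 'q, 'e \<times> 'e) form1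
      \<Rightarrow> ('q \<times> 'q \<Rightarrow> 'q \<times> 'q) \<Rightarrow> ('q \<times> 'q) set \<Rightarrow> ('q \<times> 'q) set \<Rightarrow> bool" where
  "forced_discrete_flow Q L f F U V \<longleftrightarrow>
     openin (atlas_topology (prod_atlas Q Q)) U \<and>
     openin (atlas_topology (prod_atlas Q Q)) V \<and>
     diffeomorphism_between (prod_atlas Q Q) U V F \<and>
     (\<forall>q0 q1. (q0, q1) \<in> U \<longrightarrow> (\<exists>q2. F (q0, q1) = (q1, q2) \<and> trajectory Q L f q0 q1 q2)) \<and>
     (\<forall>q0 q1 q2. trajectory Q L f q0 q1 q2 \<and> (q0, q1) \<in> U \<and> (q1, q2) \<in> V \<longrightarrow>
        F (q0, q1) = (q1, q2))"

definition legendre_plus ::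
    "('q, 'e::euclidean_space) atlas \<Rightarrow> ('q \<times> 'q \<Rightarrow> real) \<Rightarrow> ('q \<times> 'q, 'e \<times> 'e) form1
      \<Rightarrow> 'q \<times> 'q \<Rightarrow> 'q \<times> ('q, 'e) covec" where
  "legendre_plus Q L f = (\<lambda>(q0, q1).
     (q1, \<lambda>v\<in>tangent_space Q q1. D2 Q L (q0, q1) v + force_plus Q f (q0, q1) v))"

definition routh_type ::
    "('q, 'e::euclidean_space) atlas \<Rightarrow> ('q \<times> 'q, 'e \<times> 'e) form1 \<Rightarrow> ('q, 'e) form2 \<Rightarrow> bool" where
  "routh_type Q f \<beta> \<longleftrightarrow>
     smooth_form2 Q \<beta> \<and>
     form2_eq_on (prod_atlas Q Q) (points (prod_atlas Q Q))
       (form2_uminus (ext_deriv (prod_atlas Q Q) f))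
       (form2_minus (pullback2 (prod_atlas Q Q) Q snd \<beta>) (pullback2 (prod_atlas Q Q) Q fst \<beta>))"

definition omega_plus ::
    "('q, 'e::euclidean_space) atlas \<Rightarrow> ('q \<times> 'q \<Rightarrow> real) \<Rightarrow> ('q \<times> 'q, 'e \<times> 'e) form1
      \<Rightarrow> ('q, 'e) form2 \<Rightarrow> ('q \<times> 'q, 'e \<times> 'e) form2" where
  "omega_plus Q L f \<beta> =
     pullback2 (prod_atlas Q Q) (cotangent_bundle Q) (legendre_plus Q L f)
       (form2_minus (canonical_symplectic Q) (pullback2 (cotangent_bundle Q) Q fst \<beta>))"

end

theory Submission
  imports Defs
begin

text \<open>
  Write \<open>\<alpha> = dL + f\<close> for the sum of the differential of the Lagrangian and the force. A
  one-form on \<open>Q \<times> Q\<close> splits along the two factors; let \<open>\<sigma>\<close> be the part of \<open>\<alpha>\<close> that sees only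
  the second component of a tangent vector, and \<open>\<tau> = \<sigma> - \<alpha>\<close>, which is minus the part that sees only
  the first component.

  The Legendre transform sends a pair to the covector by which \<open>\<alpha>\<close> acts on the second factor, so the
  tautological property of the canonical one-form says that its pullback is \<open>\<sigma>\<close>. As the Legendre
  transform lies over the second projection, \<open>\<omega>\<^sup>+ = - d\<sigma> - pr\<^sub>2\<^sup>*\<beta>\<close> (lemma \<open>omega_plus_eq\<close>).

  The flow \<open>F\<close> satisfies \<open>pr\<^sub>1 \<circ> F = pr\<^sub>2\<close>, and the trajectory equation says exactly that
  \<open>F\<^sup>*\<tau> = \<sigma>\<close> on \<open>U\<close>: at the middle point, what \<open>\<alpha>\<close> assigns to the first factor at the later pair
  cancels what it assigns to the second factor at the earlier pair. Since \<open>ddL = 0\<close>, one has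
  \<open>d\<sigma> = d\<tau> + df\<close>, and the Routh condition reads \<open>df = pr\<^sub>1\<^sup>*\<beta> - pr\<^sub>2\<^sup>*\<beta>\<close>. Hence
  \<open>F\<^sup>*\<omega>\<^sup>+ = - F\<^sup>*d\<sigma> - F\<^sup>*pr\<^sub>2\<^sup>*\<beta> = - F\<^sup>*d\<tau> - F\<^sup>*(df + pr\<^sub>2\<^sup>*\<beta>)
    = - d\<sigma> - F\<^sup>*pr\<^sub>1\<^sup>*\<beta> = - d\<sigma> - pr\<^sub>2\<^sup>*\<beta> = \<omega>\<^sup>+\<close>.

  The analytic content is that the exterior derivative commutes with pullbacks and squares to zero
  (lemmas \<open>ext_deriv_pullback1\<close> and \<open>ext_deriv_differential\<close>); both rest on the symmetry of second
  derivatives. The rest is differential geometry in charts: the chain rule makes the tangent map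
  independent of charts and functorial, the product and the cotangent bundle carry smooth atlases, and the
  canonical one-form, the second-factor part of a one-form and the Legendre transform are smooth.
\<close>

section \<open>Calculus of smooth maps\<close>

abbreviation fderiv :: "('a::real_normed_vector \<Rightarrow> 'b::real_normed_vector) \<Rightarrow> 'a \<Rightarrow> 'a \<Rightarrow> 'b" where
  "fderiv f x \<equiv> frechet_derivative f (at x)"

lemma fderiv_eqI: "(f has_derivative f') (at x) \<Longrightarrow> fderiv f x = f'"
  using frechet_derivative_at by metis

lemma fderiv_cong_open:
  assumes "open S" "x \<in> S" "\<And>y. y \<in> S \<Longrightarrow> f y = g y" "f differentiable (at x)"
  shows "fderiv f x = fderiv g x"
  using frechet_derivative_transform_within_open[OF assms(4,1,2)] assms(3) by blast

lemma differentiable_cong_open: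
  assumes "open S" "x \<in> S" "\<And>y. y \<in> S \<Longrightarrow> f y = g y" "f differentiable (at x)"
  shows "g differentiable (at x)"
  using assms unfolding differentiable_def by (meson has_derivative_transform_within_open)

lemma linear_expand_Basis:
  assumes "linear g"
  shows "g (u::'a::euclidean_space) = (\<Sum>b\<in>Basis. (u \<bullet> b) *\<^sub>R g b)"
proof -
  have "g u = g (\<Sum>b\<in>Basis. (u \<bullet> b) *\<^sub>R b)" by (simp add: euclidean_representation)
  then show ?thesis using assms by (simp add: linear_sum linear_cmul)
qed

lemma differentiable_upto_cong:
  assumes "open S" "\<And>x. x \<in> S \<Longrightarrow> f x = g x" "differentiable_upto k S f"
  shows "differentiable_upto k S g"
  using assms(2,3)
proof (induction k arbitrary: f g)
  case 0 then show ?case using continuous_on_cong[of S S f g] by auto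
next
  case (Suc k)
  have diff: "f differentiable (at x)" if "x \<in> S" for x using Suc.prems that by auto
  have eq: "fderiv f x = fderiv g x" if "x \<in> S" for x
    by (rule fderiv_cong_open[OF assms(1) that _ diff]) (use Suc.prems that in auto)
  have "g differentiable (at x)" if "x \<in> S" for x
    by (rule differentiable_cong_open[OF assms(1) that _ diff]) (use Suc.prems that in auto)
  moreover have "differentiable_upto k S (\<lambda>x. fderiv g x v)" for v
    by (rule Suc.IH[of "\<lambda>x. fderiv f x v"]) (use Suc.prems eq in auto)
  ultimately show ?case by simp
qed

lemma differentiable_upto_SucD:
  assumes "differentiable_upto (Suc k) S f"
  shows "differentiable_upto k S f"
  using assms
proof (induction k arbitrary: f)
  case 0
  then have "f differentiable (at x)" if "x \<in> S" for x using that by simp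
  then show ?case
    by (simp add: continuous_at_imp_continuous_on differentiable_imp_continuous_within)
next
  case (Suc k)
  have "differentiable_upto (Suc k) S (\<lambda>x. fderiv f x v)" for v
    using Suc.prems by (metis differentiable_upto.simps(2))
  then have "differentiable_upto k S (\<lambda>x. fderiv f x v)" for v using Suc.IH by blast
  then show ?case using Suc.prems by (simp only: differentiable_upto.simps) simp
qed

lemma differentiable_upto_const: "differentiable_upto k S (\<lambda>x. c)"
  by (induction k arbitrary: c) auto

lemma differentiable_upto_bounded_linear:
  assumes "open S" "bounded_linear h" "differentiable_upto k S f"
  shows "differentiable_upto k S (\<lambda>x. h (f x))"
  using assms(3)
proof (induction k arbitrary: f)
  case 0
  then show ?case
    using assms(2) by (auto intro!: bounded_linear.continuous_on[OF assms(2)])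
next
  case (Suc k)
  have der: "((\<lambda>x. h (f x)) has_derivative (\<lambda>v. h (fderiv f x v))) (at x)" if "x \<in> S" for x
    using Suc.prems that by (auto intro!: bounded_linear.has_derivative[OF assms(2)]
        simp: frechet_derivative_works[symmetric])
  have "differentiable_upto k S (\<lambda>x. fderiv (\<lambda>x. h (f x)) x v)" for v
    by (rule differentiable_upto_cong[OF assms(1), of "\<lambda>x. h (fderiv f x v)"])
       (use Suc fderiv_eqI[OF der] in auto)
  then show ?case using der by (auto simp: differentiable_def)
qed

lemma differentiable_upto_add:
  assumes "open S" "differentiable_upto k S f" "differentiable_upto k S g"
  shows "differentiable_upto k S (\<lambda>x. f x + g x)"
  using assms(2,3)
proof (induction k arbitrary: f g)
  case 0
  then show ?case by (auto intro: continuous_on_add)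
next
  case (Suc k)
  have der: "((\<lambda>x. f x + g x) has_derivative (\<lambda>v. fderiv f x v + fderiv g x v)) (at x)" if "x \<in> S" for x
    using Suc.prems that by (auto intro!: has_derivative_add
        simp: frechet_derivative_works[symmetric])
  have "differentiable_upto k S (\<lambda>x. fderiv (\<lambda>x. f x + g x) x v)" for v
    by (rule differentiable_upto_cong[OF assms(1), of "\<lambda>x. fderiv f x v + fderiv g x v"])
       (use Suc fderiv_eqI[OF der] in auto)
  then show ?case using der by (auto simp: differentiable_def)
qed

lemma differentiable_upto_bilinear:
  assumes "open S" "bounded_bilinear h" "differentiable_upto k S f" "differentiable_upto k S g"
  shows "differentiable_upto k S (\<lambda>x. h (f x) (g x))"
  using assms(3,4)
proof (induction k arbitrary: f g)
  case 0
  then show ?case by (auto intro: bounded_bilinear.continuous_on[OF assms(2)])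
next
  case (Suc k)
  have der: "((\<lambda>x. h (f x) (g x)) has_derivative (\<lambda>v. h (f x) (fderiv g x v) + h (fderiv f x v) (g x))) (at x)"
    if "x \<in> S" for x
    using Suc.prems that by (auto intro!: bounded_bilinear.FDERIV[OF assms(2)]
        simp: frechet_derivative_works[symmetric])
  have fg: "differentiable_upto k S f" "differentiable_upto k S g"
    using Suc.prems differentiable_upto_SucD by blast+
  have "differentiable_upto k S (\<lambda>x. fderiv (\<lambda>x. h (f x) (g x)) x v)" for v
    by (rule differentiable_upto_cong[OF assms(1),
          of "\<lambda>x. h (f x) (fderiv g x v) + h (fderiv f x v) (g x)"])
       (use Suc fg fderiv_eqI[OF der] in \<open>auto intro!: differentiable_upto_add[OF assms(1)]\<close>)
  then show ?case using der by (auto simp: differentiable_def)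
qed

lemma differentiable_upto_sum:
  assumes "open S" "\<And>i. i \<in> I \<Longrightarrow> differentiable_upto k S (f i)"
  shows "differentiable_upto k S (\<lambda>x. \<Sum>i\<in>I. f i x)"
  using assms(2)
  by (induction I rule: infinite_finite_induct)
     (auto intro: differentiable_upto_const differentiable_upto_add[OF assms(1)])

text \<open>By the chain rule, the derivative of the composite along \<open>v\<close> is the sum over the basis vectors
  \<open>b\<close> of the product of a component of the derivative of \<open>f\<close> with the composite of \<open>f\<close> and the
  directional derivative of \<open>g\<close> along the fixed vector \<open>b\<close>. All these are covered by the
  induction hypothesis, which is why the linear map is expanded in the basis.\<close>

lemma differentiable_upto_compose:
  fixes f :: "'a::euclidean_space \<Rightarrow> 'b::euclidean_space"
  assumes "open S" "open T" "f ` S \<subseteq> T" "differentiable_upto k S f" "differentiable_upto k T g"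
  shows "differentiable_upto k S (\<lambda>x. g (f x))"
  using assms(4,5)
proof (induction k arbitrary: g)
  case 0
  then show ?case using assms(3) continuous_on_compose2 by auto
next
  case (Suc k)
  have dg: "(g has_derivative fderiv g (f x)) (at (f x))" if "x \<in> S" for x
    using Suc.prems assms(3) that by (auto simp: frechet_derivative_works[symmetric])
  have der: "((\<lambda>x. g (f x)) has_derivative (\<lambda>v. fderiv g (f x) (fderiv f x v))) (at x)"
    if "x \<in> S" for x
    using has_derivative_compose[of f "fderiv f x" x UNIV g "fderiv g (f x)"] dg[OF that] Suc.prems that
    by (auto simp: frechet_derivative_works[symmetric])
  have ex: "fderiv (\<lambda>x. g (f x)) x v = (\<Sum>b\<in>Basis. (fderiv f x v \<bullet> b) *\<^sub>R fderiv g (f x) b)"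
    if "x \<in> S" for x v
    unfolding fderiv_eqI[OF der[OF that]]
    by (rule linear_expand_Basis[OF has_derivative_linear[OF dg[OF that]]])
  have f: "differentiable_upto k S f" using Suc.prems differentiable_upto_SucD by blast
  have "differentiable_upto k S (\<lambda>x. \<Sum>b\<in>Basis. (fderiv f x v \<bullet> b) *\<^sub>R fderiv g (f x) b)" for v
  proof (intro differentiable_upto_sum differentiable_upto_bilinear[OF assms(1) bounded_bilinear_scaleR] assms(1))
    fix b :: 'b
    show "differentiable_upto k S (\<lambda>x. fderiv f x v \<bullet> b)"
      by (rule differentiable_upto_bounded_linear[OF assms(1) bounded_linear_inner_left])
         (use Suc.prems in auto)
    show "differentiable_upto k S (\<lambda>x. fderiv g (f x) b)"
      using Suc.IH[OF f, of "\<lambda>y. fderiv g y b"] Suc.prems by auto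
  qed
  then have "differentiable_upto k S (\<lambda>x. fderiv (\<lambda>x. g (f x)) x v)" for v
    by (rule differentiable_upto_cong[OF assms(1), rotated]) (use ex in auto)
  then show ?case using der by (auto simp: differentiable_def)
qed

lemma smooth_on_eq:
  assumes "open S" "smooth_on S g" "\<And>x. x \<in> S \<Longrightarrow> f x = g x"
  shows "smooth_on S f"
  unfolding smooth_on_def
proof
  fix k
  have "differentiable_upto k S g" using assms(2) unfolding smooth_on_def by blast
  then show "differentiable_upto k S f"
    by (rule differentiable_upto_cong[OF assms(1), rotated]) (simp add: assms(3))
qed

lemma smooth_on_imp_differentiable: "smooth_on S f \<Longrightarrow> x \<in> S \<Longrightarrow> f differentiable (at x)"
  unfolding smooth_on_def by (metis differentiable_upto.simps(2))

lemma smooth_on_imp_has_derivative: "smooth_on S f \<Longrightarrow> x \<in> S \<Longrightarrow> (f has_derivative fderiv f x) (at x)"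
  using smooth_on_imp_differentiable frechet_derivative_works by blast

lemma smooth_on_imp_linear: "smooth_on S f \<Longrightarrow> x \<in> S \<Longrightarrow> linear (fderiv f x)"
  using smooth_on_imp_differentiable linear_frechet_derivative by blast

lemma smooth_on_imp_continuous_on: "smooth_on S f \<Longrightarrow> continuous_on S f"
  unfolding smooth_on_def by (metis differentiable_upto.simps(1))

lemma smooth_on_fderiv: "smooth_on S f \<Longrightarrow> smooth_on S (\<lambda>x. fderiv f x v)"
  unfolding smooth_on_def by (metis differentiable_upto.simps(2))

lemma smooth_on_const: "smooth_on S (\<lambda>x. c)"
  unfolding smooth_on_def using differentiable_upto_const by blast

lemma smooth_on_ident: "smooth_on S (\<lambda>x. x)"
  unfolding smooth_on_def
proof
  fix k show "differentiable_upto k S (\<lambda>x. x)"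
    by (cases k) (auto simp: differentiable_upto_const)
qed

lemma smooth_on_bounded_linear:
  "open S \<Longrightarrow> bounded_linear h \<Longrightarrow> smooth_on S f \<Longrightarrow> smooth_on S (\<lambda>x. h (f x))"
  unfolding smooth_on_def using differentiable_upto_bounded_linear by blast

lemma smooth_on_add:
  "open S \<Longrightarrow> smooth_on S f \<Longrightarrow> smooth_on S g \<Longrightarrow> smooth_on S (\<lambda>x. f x + g x)"
  unfolding smooth_on_def using differentiable_upto_add by blast

lemma smooth_on_diff:
  assumes "open S" "smooth_on S f" "smooth_on S g"
  shows "smooth_on S (\<lambda>x. f x - g x)"
  using smooth_on_add[OF assms(1,2) smooth_on_bounded_linear[OF assms(1) _ assms(3), of uminus]]
  by (simp add: bounded_linear_minus bounded_linear_ident)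

lemma smooth_on_scaleR:
  "open S \<Longrightarrow> smooth_on S f \<Longrightarrow> smooth_on S g \<Longrightarrow> smooth_on S (\<lambda>x. f x *\<^sub>R g x)"
  unfolding smooth_on_def using differentiable_upto_bilinear[OF _ bounded_bilinear_scaleR] by blast

lemma smooth_on_inner:
  "open S \<Longrightarrow> smooth_on S f \<Longrightarrow> smooth_on S g \<Longrightarrow> smooth_on S (\<lambda>x. f x \<bullet> g x)"
  unfolding smooth_on_def using differentiable_upto_bilinear[OF _ bounded_bilinear_inner] by blast

lemma smooth_on_sum:
  "open S \<Longrightarrow> (\<And>i. i \<in> I \<Longrightarrow> smooth_on S (f i)) \<Longrightarrow> smooth_on S (\<lambda>x. \<Sum>i\<in>I. f i x)"
  unfolding smooth_on_def by (intro allI differentiable_upto_sum) auto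

lemma smooth_on_compose:
  fixes f :: "'a::euclidean_space \<Rightarrow> 'b::euclidean_space"
  shows "open S \<Longrightarrow> open T \<Longrightarrow> f ` S \<subseteq> T \<Longrightarrow> smooth_on S f \<Longrightarrow> smooth_on T g
    \<Longrightarrow> smooth_on S (\<lambda>x. g (f x))"
  unfolding smooth_on_def using differentiable_upto_compose[of S T f _ g] by simp

lemma smooth_on_Pair:
  assumes "open S" "smooth_on S f" "smooth_on S g"
  shows "smooth_on S (\<lambda>x. (f x, g x))"
proof -
  have "smooth_on S (\<lambda>x. (f x, 0) + (0, g x))"
    by (intro smooth_on_add smooth_on_bounded_linear[OF assms(1) _ assms(2), of "\<lambda>u. (u, 0)"]
        smooth_on_bounded_linear[OF assms(1) _ assms(3), of "\<lambda>u. (0, u)"] assms(1)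
        bounded_linear_Pair bounded_linear_ident bounded_linear_zero)
  then show ?thesis by simp
qed

section \<open>Symmetry of second derivatives\<close>

text \<open>The second difference over a parallelogram is symmetric in its two sides. Two applications of
  the mean value theorem, first along \<open>u\<close> and then along \<open>v\<close>, turn it into a mixed second
  derivative at some interior point.\<close>

lemma second_difference_mvt:
  fixes f :: "'a::euclidean_space \<Rightarrow> real"
  assumes "0 < h" and smooth: "smooth_on S f"
    and inS: "\<And>s t. 0 \<le> s \<Longrightarrow> s \<le> h \<Longrightarrow> 0 \<le> t \<Longrightarrow> t \<le> h \<Longrightarrow> x + s *\<^sub>R u + t *\<^sub>R v \<in> S"
  shows "\<exists>s t. 0 < s \<and> s < h \<and> 0 < t \<and> t < h \<and>
    f (x + h *\<^sub>R u + h *\<^sub>R v) - f (x + h *\<^sub>R u) - f (x + h *\<^sub>R v) + f x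
      = h * h * fderiv (\<lambda>y. fderiv f y u) (x + s *\<^sub>R u + t *\<^sub>R v) v"
proof -
  have deriv_line: "((\<lambda>s. g (y + s *\<^sub>R w)) has_real_derivative fderiv g (y + s *\<^sub>R w) w) (at s)"
    if "smooth_on S g" "y + s *\<^sub>R w \<in> S" for g :: "'a \<Rightarrow> real" and y w s
  proof -
    have g: "(g has_derivative fderiv g (y + s *\<^sub>R w)) (at (y + s *\<^sub>R w))"
      using smooth_on_imp_has_derivative that by blast
    have "((\<lambda>s. y + s *\<^sub>R w) has_derivative (\<lambda>r. r *\<^sub>R w)) (at s)"
      by (auto intro!: derivative_eq_intros)
    from has_derivative_compose[of _ _ s UNIV g, OF this g] have
      "((\<lambda>s. g (y + s *\<^sub>R w)) has_derivative (\<lambda>r. fderiv g (y + s *\<^sub>R w) (r *\<^sub>R w))) (at s)" .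
    moreover have "(\<lambda>r. fderiv g (y + s *\<^sub>R w) (r *\<^sub>R w)) = (*) (fderiv g (y + s *\<^sub>R w) w)"
      using linear_cmul[OF has_derivative_linear[OF g]] by (auto simp: mult.commute)
    ultimately show ?thesis by (simp add: has_field_derivative_def)
  qed
  define \<phi> where "\<phi> s = f ((x + h *\<^sub>R v) + s *\<^sub>R u) - f (x + s *\<^sub>R u)" for s
  have "(\<phi> has_real_derivative fderiv f ((x + h *\<^sub>R v) + s *\<^sub>R u) u - fderiv f (x + s *\<^sub>R u) u) (at s)"
    if "0 \<le> s" "s \<le> h" for s
    unfolding \<phi>_def using inS[of s h] inS[of s 0] that \<open>0 < h\<close>
    by (intro DERIV_diff deriv_line[OF smooth]) (auto simp: algebra_simps)
  from MVT2[OF \<open>0 < h\<close> this] obtain s where s: "0 < s" "s < h"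
    "\<phi> h - \<phi> 0 = h * (fderiv f ((x + h *\<^sub>R v) + s *\<^sub>R u) u - fderiv f (x + s *\<^sub>R u) u)"
    by auto
  have "((\<lambda>t. fderiv f ((x + s *\<^sub>R u) + t *\<^sub>R v) u) has_real_derivative
      fderiv (\<lambda>y. fderiv f y u) ((x + s *\<^sub>R u) + t *\<^sub>R v) v) (at t)" if "0 \<le> t" "t \<le> h" for t
    using inS[of s t] that s by (intro deriv_line[OF smooth_on_fderiv[OF smooth]]) auto
  from MVT2[OF \<open>0 < h\<close> this] obtain t where t: "0 < t" "t < h"
    "fderiv f ((x + s *\<^sub>R u) + h *\<^sub>R v) u - fderiv f (x + s *\<^sub>R u) u
       = h * fderiv (\<lambda>y. fderiv f y u) ((x + s *\<^sub>R u) + t *\<^sub>R v) v"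
    by auto
  show ?thesis
    using s t by (intro exI[of _ s] exI[of _ t]) (simp add: \<phi>_def algebra_simps)
qed

text \<open>Evaluating the same second difference in both orders shows that the two mixed derivatives agree
  at points of arbitrarily small parallelograms at \<open>x\<close>; by continuity they agree at \<open>x\<close>.\<close>

lemma second_derivative_symmetric_real:
  fixes f :: "'a::euclidean_space \<Rightarrow> real"
  assumes "open S" "x \<in> S" and smooth: "smooth_on S f"
  shows "fderiv (\<lambda>y. fderiv f y u) x v = fderiv (\<lambda>y. fderiv f y v) x u"
proof (rule ccontr)
  let ?A = "\<lambda>y. fderiv (\<lambda>y. fderiv f y u) y v"
  let ?B = "\<lambda>y. fderiv (\<lambda>y. fderiv f y v) y u"
  assume "?A x \<noteq> ?B x"
  define e where "e = \<bar>?A x - ?B x\<bar> / 2"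
  have "e > 0" using \<open>?A x \<noteq> ?B x\<close> by (simp add: e_def)
  have "isCont ?A x" "isCont ?B x"
    using smooth_on_imp_continuous_on[OF smooth_on_fderiv[OF smooth_on_fderiv[OF smooth]]] assms(1,2)
    by (auto simp: continuous_on_eq_continuous_at)
  then obtain d1 d2 where d: "d1 > 0" "d2 > 0"
    "\<And>y. dist y x < d1 \<Longrightarrow> dist (?A y) (?A x) < e"
    "\<And>y. dist y x < d2 \<Longrightarrow> dist (?B y) (?B x) < e"
    using \<open>e > 0\<close> unfolding continuous_at_eps_delta by metis
  obtain d3 where d3: "d3 > 0" "ball x d3 \<subseteq> S"
    using assms(1,2) open_contains_ball by blast
  define d where "d = min d1 (min d2 d3)"
  \<comment> \<open>The side length \<open>h\<close> is so small that the whole parallelogram lies in the ball of radius \<open>d\<close>.\<close>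
  define N where "N = 1 + norm u + norm v"
  define h where "h = d / (2 * N)"
  have "d > 0" using d d3 by (simp add: d_def)
  have pos: "0 < N" by (simp add: N_def add_pos_nonneg)
  have "h > 0" using \<open>d > 0\<close> pos by (simp add: h_def)
  have near: "dist (x + s *\<^sub>R u + t *\<^sub>R v) x < d" if "0 \<le> s" "s \<le> h" "0 \<le> t" "t \<le> h" for s t
  proof -
    have "dist (x + s *\<^sub>R u + t *\<^sub>R v) x \<le> s * norm u + t * norm v"
      using norm_triangle_ineq[of "s *\<^sub>R u" "t *\<^sub>R v"] that by (simp add: dist_norm)
    also have "\<dots> \<le> h * norm u + h * norm v"
      using that by (intro add_mono mult_right_mono) auto
    also have "\<dots> \<le> h * N" using \<open>h > 0\<close> by (simp add: N_def algebra_simps)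
    also have "\<dots> = d / 2" using pos by (simp add: h_def)
    also have "\<dots> < d" using \<open>d > 0\<close> by simp
    finally show ?thesis .
  qed
  have inS: "x + s *\<^sub>R u + t *\<^sub>R v \<in> S" if "0 \<le> s" "s \<le> h" "0 \<le> t" "t \<le> h" for s t
    using near[OF that] d3 by (auto simp: d_def dist_commute)
  obtain s t where st: "0 < s" "s < h" "0 < t" "t < h"
    "f (x + h *\<^sub>R u + h *\<^sub>R v) - f (x + h *\<^sub>R u) - f (x + h *\<^sub>R v) + f x
       = h * h * ?A (x + s *\<^sub>R u + t *\<^sub>R v)"
    using second_difference_mvt[OF \<open>h > 0\<close> smooth inS] by blast
  have inS': "x + s *\<^sub>R v + t *\<^sub>R u \<in> S" if "0 \<le> s" "s \<le> h" "0 \<le> t" "t \<le> h" for s t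
    using inS[of t s] that by (simp add: algebra_simps)
  obtain s' t' where st': "0 < s'" "s' < h" "0 < t'" "t' < h"
    "f (x + h *\<^sub>R v + h *\<^sub>R u) - f (x + h *\<^sub>R v) - f (x + h *\<^sub>R u) + f x
       = h * h * ?B (x + s' *\<^sub>R v + t' *\<^sub>R u)"
    using second_difference_mvt[OF \<open>h > 0\<close> smooth inS'] by blast
  have "h * h * ?A (x + s *\<^sub>R u + t *\<^sub>R v) = h * h * ?B (x + s' *\<^sub>R v + t' *\<^sub>R u)"
    using st(5) st'(5) by (simp add: algebra_simps)
  then have eq: "?A (x + s *\<^sub>R u + t *\<^sub>R v) = ?B (x + t' *\<^sub>R u + s' *\<^sub>R v)"
    using \<open>h > 0\<close> by (simp add: algebra_simps)
  have "dist (?A (x + s *\<^sub>R u + t *\<^sub>R v)) (?A x) < e"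
    using near[of s t] st by (intro d(3)) (auto simp: d_def)
  moreover have "dist (?B (x + t' *\<^sub>R u + s' *\<^sub>R v)) (?B x) < e"
    using near[of t' s'] st' by (intro d(4)) (auto simp: d_def)
  ultimately have "\<bar>?A x - ?B x\<bar> < 2 * e" using eq by (simp add: dist_real_def)
  then show False by (simp add: e_def)
qed

lemma second_derivative_symmetric:
  fixes f :: "'a::euclidean_space \<Rightarrow> 'b::euclidean_space"
  assumes "open S" "x \<in> S" and smooth: "smooth_on S f"
  shows "fderiv (\<lambda>y. fderiv f y u) x v = fderiv (\<lambda>y. fderiv f y v) x u"
proof (rule euclidean_eqI)
  fix b :: 'b assume "b \<in> Basis"
  have comp: "fderiv (\<lambda>y. g y \<bullet> b) y w = fderiv g y w \<bullet> b" if "smooth_on S g" "y \<in> S"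
    for g :: "'a \<Rightarrow> 'b" and y w
    using fderiv_eqI[OF bounded_linear.has_derivative[OF bounded_linear_inner_left
        smooth_on_imp_has_derivative[OF that]]] by metis
  have "fderiv (\<lambda>y. fderiv f y u) x v \<bullet> b = fderiv (\<lambda>y. fderiv (\<lambda>z. f z \<bullet> b) y u) x v" for u v
  proof -
    have "fderiv (\<lambda>y. fderiv f y u) x v \<bullet> b = fderiv (\<lambda>y. fderiv f y u \<bullet> b) x v"
      using comp[OF smooth_on_fderiv[OF smooth] assms(2)] by simp
    also have "fderiv (\<lambda>y. fderiv f y u \<bullet> b) x = fderiv (\<lambda>y. fderiv (\<lambda>z. f z \<bullet> b) y u) x"
      using comp[OF smooth]
      by (intro fderiv_cong_open[OF assms(1,2)] smooth_on_imp_differentiable[OF _ assms(2)]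
          smooth_on_bounded_linear[OF assms(1) bounded_linear_inner_left] smooth_on_fderiv smooth) auto
    finally show ?thesis .
  qed
  then show "fderiv (\<lambda>y. fderiv f y u) x v \<bullet> b = fderiv (\<lambda>y. fderiv f y v) x u \<bullet> b"
    using second_derivative_symmetric_real[OF assms(1,2) smooth_on_bounded_linear[OF assms(1) bounded_linear_inner_left smooth]]
    by simp
qed

section \<open>Charts, tangent vectors and tangent maps\<close>

lemma chart_inv_map:
  assumes "smooth_atlas A" "c \<in> A" "p \<in> chart_dom c"
  shows "chart_inv c (chart_map c p) = p"
  using assms unfolding smooth_atlas_def by (auto intro!: inv_into_f_f)

lemma chart_inv_in:
  assumes "x \<in> chart_map c ` chart_dom c"
  shows "chart_inv c x \<in> chart_dom c" "chart_map c (chart_inv c x) = x"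
  using assms by (auto intro: inv_into_into f_inv_into_f)

lemma open_chart_overlap:
  assumes "smooth_atlas A" "c \<in> A" "d \<in> A"
  shows "open (chart_map c ` (chart_dom c \<inter> chart_dom d))"
  using assms unfolding smooth_atlas_def by blast

lemma open_chart_image:
  assumes "smooth_atlas A" "c \<in> A"
  shows "open (chart_map c ` chart_dom c)"
  using open_chart_overlap[OF assms assms(2)] by simp

lemma smooth_transition:
  assumes "smooth_atlas A" "c \<in> A" "d \<in> A"
  shows "smooth_on (chart_map c ` (chart_dom c \<inter> chart_dom d)) (chart_map d \<circ> chart_inv c)"
  using assms unfolding smooth_atlas_def by blast

lemma chart_dom_subset_points: "c \<in> A \<Longrightarrow> chart_dom c \<subseteq> points A"
  unfolding points_def by blast

lemma chart_at:
  assumes "p \<in> points A"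
  shows "chart_at A p \<in> A" "p \<in> chart_dom (chart_at A p)"
proof -
  have "\<exists>c. c \<in> A \<and> p \<in> chart_dom c" using assms unfolding points_def by blast
  from someI_ex[OF this] show "chart_at A p \<in> A" "p \<in> chart_dom (chart_at A p)"
    unfolding chart_at_def by auto
qed

lemma smooth_map_on_id:
  assumes "smooth_atlas A"
  shows "smooth_map_on A A (points A) id"
  unfolding smooth_map_on_def Let_def
proof (intro conjI ballI)
  fix c d assume cd: "c \<in> A" "d \<in> A"
  have "{p \<in> chart_dom c \<inter> points A. id p \<in> chart_dom d} = chart_dom c \<inter> chart_dom d"
    using chart_dom_subset_points[OF cd(1)] by auto
  then show "open (chart_map c ` {p \<in> chart_dom c \<inter> points A. id p \<in> chart_dom d})"
    "smooth_on (chart_map c ` {p \<in> chart_dom c \<inter> points A. id p \<in> chart_dom d})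
      (chart_map d \<circ> id \<circ> chart_inv c)"
    using open_chart_overlap[OF assms cd] smooth_transition[OF assms cd] by auto
qed simp

lemma smooth_map_onD:
  assumes "smooth_map_on A B W f" "c \<in> A" "d \<in> B"
  shows "open (chart_map c ` {p \<in> chart_dom c \<inter> W. f p \<in> chart_dom d})"
    "smooth_on (chart_map c ` {p \<in> chart_dom c \<inter> W. f p \<in> chart_dom d}) (chart_map d \<circ> f \<circ> chart_inv c)"
  using assms unfolding smooth_map_on_def Let_def by auto

lemma has_derivative_local_rep:
  assumes "smooth_map_on A B W f" "c \<in> A" "d \<in> B" "p \<in> W" "p \<in> chart_dom c" "f p \<in> chart_dom d"
  shows "((chart_map d \<circ> f \<circ> chart_inv c) has_derivative
    fderiv (chart_map d \<circ> f \<circ> chart_inv c) (chart_map c p)) (at (chart_map c p))"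
  by (rule smooth_on_imp_has_derivative[OF smooth_map_onD(2)[OF assms(1-3)]]) (use assms in auto)

lemmas linear_local_rep = has_derivative_linear[OF has_derivative_local_rep]

text \<open>The chain rule in charts. The composite may be given by any map \<open>h\<close> with the germ of
  \<open>g \<circ> f\<close>; the coordinate change in the middle cancels on a neighbourhood of the point.\<close>

lemma has_derivative_local_rep_comp:
  assumes A: "smooth_atlas A" and B: "smooth_atlas B"
    and f: "smooth_map_on A B W f" and g: "smooth_map_on B C Z g"
    and h: "\<And>q. q \<in> W \<Longrightarrow> h q = g (f q)"
    and c: "c \<in> A" "p \<in> chart_dom c" and d: "d \<in> B" "f p \<in> chart_dom d"
    and e: "e \<in> C" "g (f p) \<in> chart_dom e" and p: "p \<in> W" "f p \<in> Z"
  shows "((chart_map e \<circ> h \<circ> chart_inv c) has_derivative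
      (\<lambda>u. fderiv (chart_map e \<circ> g \<circ> chart_inv d) (chart_map d (f p))
        (fderiv (chart_map d \<circ> f \<circ> chart_inv c) (chart_map c p) u))) (at (chart_map c p))"
proof -
  let ?S = "chart_map c ` {p \<in> chart_dom c \<inter> W. f p \<in> chart_dom d}"
  let ?f = "chart_map d \<circ> f \<circ> chart_inv c" and ?g = "chart_map e \<circ> g \<circ> chart_inv d"
  have fp: "?f (chart_map c p) = chart_map d (f p)"
    using chart_inv_map[OF A c] by simp
  have df: "(?f has_derivative fderiv ?f (chart_map c p)) (at (chart_map c p))"
    by (rule has_derivative_local_rep[OF f c(1) d(1) p(1) c(2) d(2)])
  have dg: "(?g has_derivative fderiv ?g (chart_map d (f p))) (at (?f (chart_map c p)))"
    unfolding fp by (rule has_derivative_local_rep[OF g d(1) e(1) p(2) d(2) e(2)])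
  have "((\<lambda>x. ?g (?f x)) has_derivative
      (\<lambda>u. fderiv ?g (chart_map d (f p)) (fderiv ?f (chart_map c p) u))) (at (chart_map c p))"
    by (rule has_derivative_compose[OF df dg])
  then show ?thesis
  proof (rule has_derivative_transform_within_open)
    show "open ?S" by (rule smooth_map_onD(1)[OF f c(1) d(1)])
    show "chart_map c p \<in> ?S" using c d p by auto
    fix x assume "x \<in> ?S"
    then show "?g (?f x) = (chart_map e \<circ> h \<circ> chart_inv c) x"
      using chart_inv_map[OF A c(1)] chart_inv_map[OF B d(1)] h by auto
  qed
qed

lemmas fderiv_local_rep_comp = fderiv_eqI[OF has_derivative_local_rep_comp]

lemma fderiv_transition_refl:
  assumes "smooth_atlas A" "c \<in> A" "p \<in> chart_dom c"
  shows "fderiv (chart_map c \<circ> chart_inv c) (chart_map c p) = (\<lambda>u. u)"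
proof (rule fderiv_eqI, rule has_derivative_transform_within_open)
  show "((\<lambda>x. x) has_derivative (\<lambda>u. u)) (at (chart_map c p))" by (rule has_derivative_ident)
  show "open (chart_map c ` chart_dom c)" by (rule open_chart_image[OF assms(1,2)])
  show "x = (chart_map c \<circ> chart_inv c) x" if "x \<in> chart_map c ` chart_dom c" for x
    using chart_inv_in[OF that] by simp
qed (use assms in auto)

lemma linear_transition:
  assumes "smooth_atlas A" "c \<in> A" "p \<in> chart_dom c" "d \<in> A" "p \<in> chart_dom d"
  shows "linear (fderiv (chart_map d \<circ> chart_inv c) (chart_map c p))"
  by (rule smooth_on_imp_linear[OF smooth_transition[OF assms(1,2,4)]]) (use assms in auto)

text \<open>The cocycle condition for coordinate changes, which is the chain rule for \<open>id \<circ> id\<close>.\<close>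

lemma fderiv_transition_trans:
  assumes "smooth_atlas A" "c \<in> A" "p \<in> chart_dom c" "d \<in> A" "p \<in> chart_dom d"
    "e \<in> A" "p \<in> chart_dom e"
  shows "fderiv (chart_map e \<circ> chart_inv d) (chart_map d p) (fderiv (chart_map d \<circ> chart_inv c) (chart_map c p) u)
    = fderiv (chart_map e \<circ> chart_inv c) (chart_map c p) u"
  using fderiv_local_rep_comp[OF assms(1,1) smooth_map_on_id[OF assms(1)] smooth_map_on_id[OF assms(1)],
      of id c p d e] assms chart_dom_subset_points[of c A] by auto

lemma tangent_space_change:
  assumes "v \<in> tangent_space A p" "c \<in> A" "d \<in> A" "p \<in> chart_dom c" "p \<in> chart_dom d"
  shows "v d = fderiv (chart_map d \<circ> chart_inv c) (chart_map c p) (v c)"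
  using assms unfolding tangent_space_def by blast

lemma tangent_space_outside:
  assumes "v \<in> tangent_space A p" "\<not> (c \<in> A \<and> p \<in> chart_dom c)"
  shows "v c = 0"
  using assms unfolding tangent_space_def by blast

lemma tangent_spaceI:
  assumes "\<And>c. \<not> (c \<in> A \<and> p \<in> chart_dom c) \<Longrightarrow> v c = 0"
    and "\<And>c d. c \<in> A \<Longrightarrow> p \<in> chart_dom c \<Longrightarrow> d \<in> A \<Longrightarrow> p \<in> chart_dom d
      \<Longrightarrow> v d = fderiv (chart_map d \<circ> chart_inv c) (chart_map c p) (v c)"
  shows "v \<in> tangent_space A p"
  using assms unfolding tangent_space_def by blast

lemma tangent_space_eqI:
  assumes "v \<in> tangent_space A p" "w \<in> tangent_space A p" "c \<in> A" "p \<in> chart_dom c" "v c = w c"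
  shows "v = w"
proof
  fix d
  show "v d = w d"
  proof (cases "d \<in> A \<and> p \<in> chart_dom d")
    case True
    then show ?thesis
      using tangent_space_change[OF assms(1,3) _ assms(4), of d]
        tangent_space_change[OF assms(2,3) _ assms(4), of d] assms(5) by simp
  next
    case False
    then show ?thesis using tangent_space_outside assms(1,2) by metis
  qed
qed

lemma coord_vec_in_tangent_space:
  assumes "smooth_atlas A" "c \<in> A" "p \<in> chart_dom c"
  shows "coord_vec A c p u \<in> tangent_space A p"
proof (rule tangent_spaceI)
  fix d e assume "d \<in> A" "p \<in> chart_dom d" "e \<in> A" "p \<in> chart_dom e"
  then show "coord_vec A c p u e = fderiv (chart_map e \<circ> chart_inv d) (chart_map d p) (coord_vec A c p u d)"
    using fderiv_transition_trans[OF assms] by (simp add: coord_vec_def)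
qed (auto simp: coord_vec_def)

lemma coord_vec_same:
  assumes "smooth_atlas A" "c \<in> A" "p \<in> chart_dom c"
  shows "coord_vec A c p u c = u"
  using fderiv_transition_refl[OF assms] assms by (simp add: coord_vec_def)

lemma coord_vec_component:
  assumes "smooth_atlas A" "c \<in> A" "p \<in> chart_dom c" "v \<in> tangent_space A p"
  shows "coord_vec A c p (v c) = v"
  by (rule tangent_space_eqI[OF coord_vec_in_tangent_space[OF assms(1-3)] assms(4,2,3)
      coord_vec_same[OF assms(1-3)]])

lemma coord_vec_add:
  assumes "smooth_atlas A" "c \<in> A" "p \<in> chart_dom c"
  shows "coord_vec A c p (u + w) = tadd (coord_vec A c p u) (coord_vec A c p w)"
  using linear_add[OF linear_transition[OF assms]] by (intro ext) (simp add: coord_vec_def tadd_def)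

lemma coord_vec_scale:
  assumes "smooth_atlas A" "c \<in> A" "p \<in> chart_dom c"
  shows "coord_vec A c p (r *\<^sub>R u) = tscale r (coord_vec A c p u)"
  using linear_cmul[OF linear_transition[OF assms]] by (intro ext) (simp add: coord_vec_def tscale_def)

lemma tadd_in_tangent_space:
  assumes "smooth_atlas A" "v \<in> tangent_space A p" "w \<in> tangent_space A p"
  shows "tadd v w \<in> tangent_space A p"
proof (rule tangent_spaceI)
  fix c d assume "c \<in> A" "p \<in> chart_dom c" "d \<in> A" "p \<in> chart_dom d"
  then show "tadd v w d = fderiv (chart_map d \<circ> chart_inv c) (chart_map c p) (tadd v w c)"
    using linear_add[OF linear_transition[OF assms(1), of c p d]]
      tangent_space_change[OF assms(2), of c d] tangent_space_change[OF assms(3), of c d]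
    by (simp add: tadd_def)
qed (use assms in \<open>simp add: tangent_space_outside tadd_def\<close>)

lemma tscale_in_tangent_space:
  assumes "smooth_atlas A" "v \<in> tangent_space A p"
  shows "tscale r v \<in> tangent_space A p"
proof (rule tangent_spaceI)
  fix c d assume "c \<in> A" "p \<in> chart_dom c" "d \<in> A" "p \<in> chart_dom d"
  then show "tscale r v d = fderiv (chart_map d \<circ> chart_inv c) (chart_map c p) (tscale r v c)"
    using linear_cmul[OF linear_transition[OF assms(1), of c p d]]
      tangent_space_change[OF assms(2), of c d] by (simp add: tscale_def)
qed (use assms in \<open>simp add: tangent_space_outside tscale_def\<close>)

lemma tzero_in_tangent_space:
  assumes "smooth_atlas A"
  shows "tzero \<in> tangent_space A p"
proof (rule tangent_spaceI)
  fix c d assume "c \<in> A" "p \<in> chart_dom c" "d \<in> A" "p \<in> chart_dom d"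
  then show "tzero d = fderiv (chart_map d \<circ> chart_inv c) (chart_map c p) (tzero c)"
    using linear_0[OF linear_transition[OF assms(1), of c p d]] by (simp add: tzero_def)
qed (simp add: tzero_def)

text \<open>The tangent map is defined with one arbitrarily chosen chart of the source; it can be computed in
  every other one.\<close>

lemma tangent_map_component:
  assumes A: "smooth_atlas A" and f: "smooth_map_on A B W f"
    and p: "p \<in> W" and c: "c \<in> A" "p \<in> chart_dom c" and d: "d \<in> B" "f p \<in> chart_dom d"
    and v: "v \<in> tangent_space A p"
  shows "tangent_map A B f p v d = fderiv (chart_map d \<circ> f \<circ> chart_inv c) (chart_map c p) (v c)"
proof -
  have pA: "p \<in> points A" using c unfolding points_def by blast
  note e = chart_at[OF pA]
  have idA: "smooth_map_on A A (points A) id" by (rule smooth_map_on_id[OF A])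
  \<comment> \<open>Precompose with the identity, read in the charts \<open>c\<close> and \<open>chart_at A p\<close>.\<close>
  have "fderiv (chart_map d \<circ> f \<circ> chart_inv c) (chart_map c p) =
     (\<lambda>u. fderiv (chart_map d \<circ> f \<circ> chart_inv (chart_at A p)) (chart_map (chart_at A p) p)
        (fderiv (chart_map (chart_at A p) \<circ> chart_inv c) (chart_map c p) u))"
    using fderiv_local_rep_comp[OF A A idA f, of f c p "chart_at A p" d] assms e pA by simp
  then show ?thesis
    using d tangent_space_change[OF v c(1) e(1) c(2) e(2)] by (simp add: tangent_map_def Let_def)
qed

lemma tangent_map_in_tangent_space:
  assumes A: "smooth_atlas A" and B: "smooth_atlas B" and f: "smooth_map_on A B W f" and p: "p \<in> W" "p \<in> points A"
    and v: "v \<in> tangent_space A p"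
  shows "tangent_map A B f p v \<in> tangent_space B (f p)"
proof (rule tangent_spaceI)
  fix d e assume d: "d \<in> B" "f p \<in> chart_dom d" and e: "e \<in> B" "f p \<in> chart_dom e"
  note c = chart_at[OF p(2)]
  have idB: "smooth_map_on B B (points B) id" by (rule smooth_map_on_id[OF B])
  have "fderiv (chart_map e \<circ> f \<circ> chart_inv (chart_at A p)) (chart_map (chart_at A p) p) =
     (\<lambda>u. fderiv (chart_map e \<circ> chart_inv d) (chart_map d (f p))
        (fderiv (chart_map d \<circ> f \<circ> chart_inv (chart_at A p)) (chart_map (chart_at A p) p) u))"
    using fderiv_local_rep_comp[OF A B f idB, of f "chart_at A p" p d e] d e c p
      chart_dom_subset_points[OF d(1)] by auto
  then show "tangent_map A B f p v e =
      fderiv (chart_map e \<circ> chart_inv d) (chart_map d (f p)) (tangent_map A B f p v d)"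
    using d e by (simp add: tangent_map_def Let_def)
qed (auto simp: tangent_map_def Let_def)

lemma tangent_map_coord_vec:
  assumes A: "smooth_atlas A" and B: "smooth_atlas B" and f: "smooth_map_on A B W f"
    and p: "p \<in> W" and c: "c \<in> A" "p \<in> chart_dom c" and d: "d \<in> B" "f p \<in> chart_dom d"
  shows "tangent_map A B f p (coord_vec A c p u) =
    coord_vec B d (f p) (fderiv (chart_map d \<circ> f \<circ> chart_inv c) (chart_map c p) u)"
proof (rule tangent_space_eqI[OF _ _ d])
  have cv: "coord_vec A c p u \<in> tangent_space A p" by (rule coord_vec_in_tangent_space[OF A c])
  have pA: "p \<in> points A" using c chart_dom_subset_points by blast
  show "tangent_map A B f p (coord_vec A c p u) \<in> tangent_space B (f p)"
    by (rule tangent_map_in_tangent_space[OF A B f p pA cv])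
  show "coord_vec B d (f p) (fderiv (chart_map d \<circ> f \<circ> chart_inv c) (chart_map c p) u) \<in> tangent_space B (f p)"
    by (rule coord_vec_in_tangent_space[OF B d])
  show "tangent_map A B f p (coord_vec A c p u) d =
    coord_vec B d (f p) (fderiv (chart_map d \<circ> f \<circ> chart_inv c) (chart_map c p) u) d"
    using tangent_map_component[OF A f p c d cv] by (simp add: coord_vec_same[OF A c] coord_vec_same[OF B d])
qed

text \<open>Functoriality. Stated for any \<open>h\<close> that agrees with \<open>g \<circ> f\<close> on \<open>W\<close>, as the second projection
  equals the composite of a flow with the first projection only on the domain of the flow.\<close>

lemma tangent_map_comp:
  assumes A: "smooth_atlas A" and B: "smooth_atlas B"
    and f: "smooth_map_on A B W f" and g: "smooth_map_on B C Z g"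
    and h: "\<And>q. q \<in> W \<Longrightarrow> h q = g (f q)"
    and p: "p \<in> W" "p \<in> points A" "f p \<in> Z" "f p \<in> points B" and v: "v \<in> tangent_space A p"
  shows "tangent_map A C h p v = tangent_map B C g (f p) (tangent_map A B f p v)"
proof
  fix e
  note c = chart_at[OF p(2)] and d = chart_at[OF p(4)]
  show "tangent_map A C h p v e = tangent_map B C g (f p) (tangent_map A B f p v) e"
  proof (cases "e \<in> C \<and> g (f p) \<in> chart_dom e")
    case True
    then have e: "e \<in> C" "g (f p) \<in> chart_dom e" by auto
    show ?thesis
      using fderiv_local_rep_comp[OF A B f g h c d e p(1,3)] e d h[OF p(1)]
      by (simp add: tangent_map_def Let_def)
  next
    case False
    then show ?thesis using h[OF p(1)] by (auto simp: tangent_map_def Let_def)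
  qed
qed

lemma tangent_map_linear:
  assumes A: "smooth_atlas A" and f: "smooth_map_on A B W f" and p: "p \<in> W" "p \<in> points A"
  shows "tangent_map A B f p (tadd v w) = tadd (tangent_map A B f p v) (tangent_map A B f p w)"
    and "tangent_map A B f p (tscale r v) = tscale r (tangent_map A B f p v)"
proof -
  note c = chart_at[OF p(2)]
  note lin = linear_local_rep[OF f c(1) _ p(1) c(2)]
  show "tangent_map A B f p (tadd v w) = tadd (tangent_map A B f p v) (tangent_map A B f p w)"
    using linear_add[OF lin] by (intro ext) (simp add: tangent_map_def Let_def tadd_def)
  show "tangent_map A B f p (tscale r v) = tscale r (tangent_map A B f p v)"
    using linear_cmul[OF lin] by (intro ext) (simp add: tangent_map_def Let_def tscale_def)
qed

section \<open>Product manifolds\<close>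

definition prod_chart :: "('m, 'e) chart \<Rightarrow> ('n, 'f) chart \<Rightarrow> ('m \<times> 'n, 'e \<times> 'f) chart" where
  "prod_chart c d = (chart_dom c \<times> chart_dom d, map_prod (chart_map c) (chart_map d))"

lemma chart_dom_prod_chart [simp]: "chart_dom (prod_chart c d) = chart_dom c \<times> chart_dom d"
  and chart_map_prod_chart [simp]: "chart_map (prod_chart c d) = map_prod (chart_map c) (chart_map d)"
  by (simp_all add: prod_chart_def)

lemma in_prod_atlas_iff: "e \<in> prod_atlas A B \<longleftrightarrow> (\<exists>c\<in>A. \<exists>d\<in>B. e = prod_chart c d)"
  unfolding prod_atlas_def prod_chart_def by blast

lemma prod_chart_in_prod_atlas: "c \<in> A \<Longrightarrow> d \<in> B \<Longrightarrow> prod_chart c d \<in> prod_atlas A B"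
  unfolding in_prod_atlas_iff by blast

lemma points_prod_atlas: "points (prod_atlas A B) = points A \<times> points B"
proof (rule set_eqI)
  fix p
  have "p \<in> points (prod_atlas A B) \<longleftrightarrow> (\<exists>e. (\<exists>c\<in>A. \<exists>d\<in>B. e = prod_chart c d) \<and> p \<in> chart_dom e)"
    unfolding points_def in_prod_atlas_iff[symmetric] by blast
  also have "\<dots> \<longleftrightarrow> (\<exists>c\<in>A. \<exists>d\<in>B. p \<in> chart_dom (prod_chart c d))" by blast
  also have "\<dots> \<longleftrightarrow> p \<in> points A \<times> points B"
    unfolding points_def chart_dom_prod_chart mem_Times_iff by blast
  finally show "p \<in> points (prod_atlas A B) \<longleftrightarrow> p \<in> points A \<times> points B" .
qed

lemma map_prod_image_Times: "map_prod f g ` (S \<times> T) = f ` S \<times> g ` T"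
  by (rule map_prod_surj_on) auto

lemma inj_on_prod_chart:
  assumes "smooth_atlas A" "c \<in> A" "smooth_atlas B" "d \<in> B"
  shows "inj_on (chart_map (prod_chart c d)) (chart_dom (prod_chart c d))"
proof -
  have "inj_on (chart_map c) (chart_dom c)" "inj_on (chart_map d) (chart_dom d)"
    using assms unfolding smooth_atlas_def by blast+
  then show ?thesis by (simp add: map_prod_inj_on)
qed

lemma chart_inv_prod_chart:
  assumes A: "smooth_atlas A" "c \<in> A" and B: "smooth_atlas B" "d \<in> B"
    and x: "x \<in> chart_map c ` chart_dom c" "y \<in> chart_map d ` chart_dom d"
  shows "chart_inv (prod_chart c d) (x, y) = (chart_inv c x, chart_inv d y)"
proof (rule inv_into_f_eq)
  show "inj_on (chart_map (prod_chart c d)) (chart_dom (prod_chart c d))"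
    by (rule inj_on_prod_chart[OF A B])
  show "(chart_inv c x, chart_inv d y) \<in> chart_dom (prod_chart c d)"
    "chart_map (prod_chart c d) (chart_inv c x, chart_inv d y) = (x, y)"
    using chart_inv_in[OF x(1)] chart_inv_in[OF x(2)] by auto
qed

lemma smooth_on_fst:
  fixes f :: "'a::euclidean_space \<Rightarrow> 'c::real_normed_vector"
  assumes "open S" "open T" "smooth_on S f"
  shows "smooth_on (S \<times> (T :: 'b::euclidean_space set)) (\<lambda>z. f (fst z))"
  by (rule smooth_on_compose[of "S \<times> T" S fst f])
     (use assms in \<open>auto intro: open_Times smooth_on_bounded_linear[OF _ bounded_linear_fst smooth_on_ident]\<close>)

lemma smooth_on_snd:
  fixes f :: "'b::euclidean_space \<Rightarrow> 'c::real_normed_vector"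
  assumes "open S" "open T" "smooth_on T f"
  shows "smooth_on ((S :: 'a::euclidean_space set) \<times> T) (\<lambda>z. f (snd z))"
  by (rule smooth_on_compose[of "S \<times> T" T snd f])
     (use assms in \<open>auto intro: open_Times smooth_on_bounded_linear[OF _ bounded_linear_snd smooth_on_ident]\<close>)

lemma smooth_atlas_prod_atlas:
  fixes A :: "('m, 'e::euclidean_space) atlas" and B :: "('n, 'f::euclidean_space) atlas"
  assumes A: "smooth_atlas A" and B: "smooth_atlas B"
  shows "smooth_atlas (prod_atlas A B)"
  unfolding smooth_atlas_def
proof (intro conjI ballI)
  fix e assume "e \<in> prod_atlas A B"
  then show "inj_on (chart_map e) (chart_dom e)"
    using inj_on_prod_chart[OF A _ B] unfolding in_prod_atlas_iff by blast
next
  fix e e' assume "e \<in> prod_atlas A B" "e' \<in> prod_atlas A B"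
  then obtain c d c' d' where e: "e = prod_chart c d" "e' = prod_chart c' d'"
    and c: "c \<in> A" "c' \<in> A" and d: "d \<in> B" "d' \<in> B"
    unfolding in_prod_atlas_iff by blast
  let ?S = "chart_map c ` (chart_dom c \<inter> chart_dom c')" and ?T = "chart_map d ` (chart_dom d \<inter> chart_dom d')"
  have img: "chart_map e ` (chart_dom e \<inter> chart_dom e') = ?S \<times> ?T"
    by (simp add: e Times_Int_Times map_prod_image_Times)
  have S: "open ?S" and T: "open ?T"
    using open_chart_overlap[OF A c] open_chart_overlap[OF B d] by auto
  show "open (chart_map e ` (chart_dom e \<inter> chart_dom e'))"
    unfolding img using S T by (rule open_Times)
  have "smooth_on (?S \<times> ?T) (\<lambda>z. ((chart_map c' \<circ> chart_inv c) (fst z), (chart_map d' \<circ> chart_inv d) (snd z)))"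
    by (rule smooth_on_Pair[OF open_Times[OF S T] smooth_on_fst[OF S T smooth_transition[OF A c]]
          smooth_on_snd[OF S T smooth_transition[OF B d]]])
  moreover have "(chart_map e' \<circ> chart_inv e) z =
      ((chart_map c' \<circ> chart_inv c) (fst z), (chart_map d' \<circ> chart_inv d) (snd z))" if "z \<in> ?S \<times> ?T" for z
    using chart_inv_prod_chart[OF A c(1) B d(1), of "fst z" "snd z"] that by (auto simp: e)
  ultimately show "smooth_on (chart_map e ` (chart_dom e \<inter> chart_dom e')) (chart_map e' \<circ> chart_inv e)"
    unfolding img by (rule smooth_on_eq[OF open_Times[OF S T]])
qed

lemma smooth_map_on_fst:
  fixes A :: "('m, 'e::euclidean_space) atlas" and B :: "('n, 'f::euclidean_space) atlas"
  assumes A: "smooth_atlas A" and B: "smooth_atlas B"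
  shows "smooth_map_on (prod_atlas A B) A (points (prod_atlas A B)) fst"
  unfolding smooth_map_on_def Let_def
proof (intro conjI ballI)
  show "fst ` points (prod_atlas A B) \<subseteq> points A" by (auto simp: points_prod_atlas)
  fix e c' assume "e \<in> prod_atlas A B" and c': "c' \<in> A"
  then obtain c d where e: "e = prod_chart c d" and c: "c \<in> A" and d: "d \<in> B"
    unfolding in_prod_atlas_iff by blast
  let ?S = "chart_map c ` (chart_dom c \<inter> chart_dom c')" and ?T = "chart_map d ` chart_dom d"
  have "{p \<in> chart_dom e \<inter> points (prod_atlas A B). fst p \<in> chart_dom c'}
      = (chart_dom c \<inter> chart_dom c') \<times> chart_dom d"
    using chart_dom_subset_points[OF c] chart_dom_subset_points[OF d] by (auto simp: e points_prod_atlas)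
  then have img: "chart_map e ` {p \<in> chart_dom e \<inter> points (prod_atlas A B). fst p \<in> chart_dom c'} = ?S \<times> ?T"
    by (simp add: e map_prod_image_Times)
  have S: "open ?S" and T: "open ?T"
    using open_chart_overlap[OF A c c'] open_chart_image[OF B d] by auto
  show "open (chart_map e ` {p \<in> chart_dom e \<inter> points (prod_atlas A B). fst p \<in> chart_dom c'})"
    unfolding img using S T by (rule open_Times)
  have "smooth_on (?S \<times> ?T) (\<lambda>z. (chart_map c' \<circ> chart_inv c) (fst z))"
    by (rule smooth_on_fst[OF S T smooth_transition[OF A c c']])
  moreover have "(chart_map c' \<circ> fst \<circ> chart_inv e) z = (chart_map c' \<circ> chart_inv c) (fst z)"
    if "z \<in> ?S \<times> ?T" for z
    using chart_inv_prod_chart[OF A c B d, of "fst z" "snd z"] that by (auto simp: e)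
  ultimately show "smooth_on (chart_map e ` {p \<in> chart_dom e \<inter> points (prod_atlas A B). fst p \<in> chart_dom c'})
      (chart_map c' \<circ> fst \<circ> chart_inv e)"
    unfolding img by (rule smooth_on_eq[OF open_Times[OF S T]])
qed

lemma smooth_map_on_snd:
  fixes A :: "('m, 'e::euclidean_space) atlas" and B :: "('n, 'f::euclidean_space) atlas"
  assumes A: "smooth_atlas A" and B: "smooth_atlas B"
  shows "smooth_map_on (prod_atlas A B) B (points (prod_atlas A B)) snd"
  unfolding smooth_map_on_def Let_def
proof (intro conjI ballI)
  show "snd ` points (prod_atlas A B) \<subseteq> points B" by (auto simp: points_prod_atlas)
  fix e d' assume "e \<in> prod_atlas A B" and d': "d' \<in> B"
  then obtain c d where e: "e = prod_chart c d" and c: "c \<in> A" and d: "d \<in> B"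
    unfolding in_prod_atlas_iff by blast
  let ?S = "chart_map c ` chart_dom c" and ?T = "chart_map d ` (chart_dom d \<inter> chart_dom d')"
  have "{p \<in> chart_dom e \<inter> points (prod_atlas A B). snd p \<in> chart_dom d'}
      = chart_dom c \<times> (chart_dom d \<inter> chart_dom d')"
    using chart_dom_subset_points[OF c] chart_dom_subset_points[OF d] by (auto simp: e points_prod_atlas)
  then have img: "chart_map e ` {p \<in> chart_dom e \<inter> points (prod_atlas A B). snd p \<in> chart_dom d'} = ?S \<times> ?T"
    by (simp add: e map_prod_image_Times)
  have S: "open ?S" and T: "open ?T"
    using open_chart_overlap[OF B d d'] open_chart_image[OF A c] by auto
  show "open (chart_map e ` {p \<in> chart_dom e \<inter> points (prod_atlas A B). snd p \<in> chart_dom d'})"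
    unfolding img using S T by (rule open_Times)
  have "smooth_on (?S \<times> ?T) (\<lambda>z. (chart_map d' \<circ> chart_inv d) (snd z))"
    by (rule smooth_on_snd[OF S T smooth_transition[OF B d d']])
  moreover have "(chart_map d' \<circ> snd \<circ> chart_inv e) z = (chart_map d' \<circ> chart_inv d) (snd z)"
    if "z \<in> ?S \<times> ?T" for z
    using chart_inv_prod_chart[OF A c B d, of "fst z" "snd z"] that by (auto simp: e)
  ultimately show "smooth_on (chart_map e ` {p \<in> chart_dom e \<inter> points (prod_atlas A B). snd p \<in> chart_dom d'})
      (chart_map d' \<circ> snd \<circ> chart_inv e)"
    unfolding img by (rule smooth_on_eq[OF open_Times[OF S T]])
qed

lemma fderiv_local_rep_proj:
  assumes A: "smooth_atlas A" "c \<in> A" and B: "smooth_atlas B" "d \<in> B"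
    and x: "x \<in> chart_map c ` chart_dom c" "y \<in> chart_map d ` chart_dom d"
  shows "fderiv (chart_map c \<circ> fst \<circ> chart_inv (prod_chart c d)) (x, y) = fst"
    and "fderiv (chart_map d \<circ> snd \<circ> chart_inv (prod_chart c d)) (x, y) = snd"
proof -
  let ?S = "chart_map c ` chart_dom c \<times> chart_map d ` chart_dom d"
  have S: "open ?S" "(x, y) \<in> ?S"
    using open_Times[OF open_chart_image[OF A] open_chart_image[OF B]] x by auto
  have eq: "fst z = (chart_map c \<circ> fst \<circ> chart_inv (prod_chart c d)) z"
    "snd z = (chart_map d \<circ> snd \<circ> chart_inv (prod_chart c d)) z" if "z \<in> ?S" for z
    using chart_inv_prod_chart[OF A B, of "fst z" "snd z"] chart_inv_in[of "fst z" c]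
      chart_inv_in[of "snd z" d] that by auto
  show "fderiv (chart_map c \<circ> fst \<circ> chart_inv (prod_chart c d)) (x, y) = fst"
    by (rule fderiv_eqI, rule has_derivative_transform_within_open[OF _ S eq(1)])
       (auto intro!: derivative_eq_intros)
  show "fderiv (chart_map d \<circ> snd \<circ> chart_inv (prod_chart c d)) (x, y) = snd"
    by (rule fderiv_eqI, rule has_derivative_transform_within_open[OF _ S eq(2)])
       (auto intro!: derivative_eq_intros)
qed

lemma tangent_map_proj_component:
  assumes A: "smooth_atlas A" "c \<in> A" "p \<in> chart_dom c" and B: "smooth_atlas B" "d \<in> B" "q \<in> chart_dom d"
    and u: "u \<in> tangent_space (prod_atlas A B) (p, q)"
  shows "tangent_map (prod_atlas A B) A fst (p, q) u c = fst (u (prod_chart c d))"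
    and "tangent_map (prod_atlas A B) B snd (p, q) u d = snd (u (prod_chart c d))"
proof -
  have M: "smooth_atlas (prod_atlas A B)" by (rule smooth_atlas_prod_atlas[OF A(1) B(1)])
  have cd: "prod_chart c d \<in> prod_atlas A B" "(p, q) \<in> chart_dom (prod_chart c d)"
    using A B by (auto intro: prod_chart_in_prod_atlas)
  then have pq: "(p, q) \<in> points (prod_atlas A B)" using chart_dom_subset_points by blast
  show "tangent_map (prod_atlas A B) A fst (p, q) u c = fst (u (prod_chart c d))"
    using tangent_map_component[OF M smooth_map_on_fst[OF A(1) B(1)] pq cd A(2) _ u]
      fderiv_local_rep_proj(1)[OF A(1,2) B(1,2), of "chart_map c p" "chart_map d q"] A B by simp
  show "tangent_map (prod_atlas A B) B snd (p, q) u d = snd (u (prod_chart c d))"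
    using tangent_map_component[OF M smooth_map_on_snd[OF A(1) B(1)] pq cd B(2) _ u]
      fderiv_local_rep_proj(2)[OF A(1,2) B(1,2), of "chart_map c p" "chart_map d q"] A B by simp
qed

lemma tangent_map_proj_in_tangent_space:
  assumes "smooth_atlas A" "smooth_atlas B" "p \<in> points (prod_atlas A B)"
    "u \<in> tangent_space (prod_atlas A B) p"
  shows "tangent_map (prod_atlas A B) A fst p u \<in> tangent_space A (fst p)"
    and "tangent_map (prod_atlas A B) B snd p u \<in> tangent_space B (snd p)"
  using tangent_map_in_tangent_space[OF smooth_atlas_prod_atlas[OF assms(1,2)] assms(1)
      smooth_map_on_fst[OF assms(1,2)] assms(3,3,4)]
    tangent_map_in_tangent_space[OF smooth_atlas_prod_atlas[OF assms(1,2)] assms(2)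
      smooth_map_on_snd[OF assms(1,2)] assms(3,3,4)] by auto

text \<open>This discharges the definite description in \<^const>\<open>tpair\<close>: in a product chart a tangent vector of
  the product is the pair of the components of its two projections, so there is exactly one with
  given projections.\<close>

lemma tpair_eq_coord_vec:
  assumes A: "smooth_atlas A" "c \<in> A" "p \<in> chart_dom c" and B: "smooth_atlas B" "d \<in> B" "q \<in> chart_dom d"
    and v: "v \<in> tangent_space A p" and w: "w \<in> tangent_space B q"
  shows "tpair A B p q v w = coord_vec (prod_atlas A B) (prod_chart c d) (p, q) (v c, w d)"
  unfolding tpair_def
proof (rule the_equality)
  let ?u = "coord_vec (prod_atlas A B) (prod_chart c d) (p, q) (v c, w d)"
  have M: "smooth_atlas (prod_atlas A B)" by (rule smooth_atlas_prod_atlas[OF A(1) B(1)])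
  have cd: "prod_chart c d \<in> prod_atlas A B" "(p, q) \<in> chart_dom (prod_chart c d)"
    using A B by (auto intro: prod_chart_in_prod_atlas)
  then have pq: "(p, q) \<in> points (prod_atlas A B)" using chart_dom_subset_points by blast
  have u: "?u \<in> tangent_space (prod_atlas A B) (p, q)" by (rule coord_vec_in_tangent_space[OF M cd])
  have "tangent_map (prod_atlas A B) A fst (p, q) ?u = v"
    using tangent_space_eqI[OF _ v A(2,3)] tangent_map_proj_in_tangent_space(1)[OF A(1) B(1) pq u]
      tangent_map_proj_component(1)[OF A B u] coord_vec_same[OF M cd] by simp
  moreover have "tangent_map (prod_atlas A B) B snd (p, q) ?u = w"
    using tangent_space_eqI[OF _ w B(2,3)] tangent_map_proj_in_tangent_space(2)[OF A(1) B(1) pq u]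
      tangent_map_proj_component(2)[OF A B u] coord_vec_same[OF M cd] by simp
  ultimately show "?u \<in> tangent_space (prod_atlas A B) (p, q) \<and>
    tangent_map (prod_atlas A B) A fst (p, q) ?u = v \<and> tangent_map (prod_atlas A B) B snd (p, q) ?u = w"
    using u by blast
  fix u' assume u': "u' \<in> tangent_space (prod_atlas A B) (p, q) \<and>
    tangent_map (prod_atlas A B) A fst (p, q) u' = v \<and> tangent_map (prod_atlas A B) B snd (p, q) u' = w"
  then have "u' (prod_chart c d) = (v c, w d)"
    using tangent_map_proj_component[OF A B, of u'] by (simp add: prod_eq_iff)
  then show "u' = ?u"
    using u' by (intro tangent_space_eqI[OF _ u cd]) (auto simp: coord_vec_same[OF M cd])
qed

lemma tpair_in_tangent_space:
  assumes "smooth_atlas A" "p \<in> points A" "smooth_atlas B" "q \<in> points B"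
    and "v \<in> tangent_space A p" "w \<in> tangent_space B q"
  shows "tpair A B p q v w \<in> tangent_space (prod_atlas A B) (p, q)"
  using tpair_eq_coord_vec[OF assms(1) chart_at[OF assms(2)] assms(3) chart_at[OF assms(4)] assms(5,6)]
    chart_at[OF assms(2)] chart_at[OF assms(4)]
  by (auto intro!: coord_vec_in_tangent_space smooth_atlas_prod_atlas assms prod_chart_in_prod_atlas)

lemma tpair_tadd:
  assumes A: "smooth_atlas A" "p \<in> points A" and B: "smooth_atlas B" "q \<in> points B"
    and v: "v \<in> tangent_space A p" "v' \<in> tangent_space A p"
    and w: "w \<in> tangent_space B q" "w' \<in> tangent_space B q"
  shows "tpair A B p q (tadd v v') (tadd w w') = tadd (tpair A B p q v w) (tpair A B p q v' w')"
  using tpair_eq_coord_vec[OF A(1) chart_at[OF A(2)] B(1) chart_at[OF B(2)]] v w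
    tadd_in_tangent_space[OF A(1) v] tadd_in_tangent_space[OF B(1) w]
    coord_vec_add[OF smooth_atlas_prod_atlas[OF A(1) B(1)], of "prod_chart (chart_at A p) (chart_at B q)" "(p, q)"]
    prod_chart_in_prod_atlas[OF chart_at(1)[OF A(2)] chart_at(1)[OF B(2)]] chart_at[OF A(2)] chart_at[OF B(2)]
  by (simp add: tadd_def flip: add_Pair)

lemma tpair_tscale:
  assumes A: "smooth_atlas A" "p \<in> points A" and B: "smooth_atlas B" "q \<in> points B"
    and v: "v \<in> tangent_space A p" and w: "w \<in> tangent_space B q"
  shows "tpair A B p q (tscale r v) (tscale r w) = tscale r (tpair A B p q v w)"
  using tpair_eq_coord_vec[OF A(1) chart_at[OF A(2)] B(1) chart_at[OF B(2)]] v w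
    tscale_in_tangent_space[OF A(1) v] tscale_in_tangent_space[OF B(1) w]
    coord_vec_scale[OF smooth_atlas_prod_atlas[OF A(1) B(1)], of "prod_chart (chart_at A p) (chart_at B q)" "(p, q)"]
    prod_chart_in_prod_atlas[OF chart_at(1)[OF A(2)] chart_at(1)[OF B(2)]] chart_at[OF A(2)] chart_at[OF B(2)]
  by (simp add: tscale_def flip: scaleR_Pair)

lemma tpair_tangent_map_proj:
  assumes A: "smooth_atlas A" and B: "smooth_atlas B" and p: "p \<in> points (prod_atlas A B)"
    and u: "u \<in> tangent_space (prod_atlas A B) p"
  shows "tpair A B (fst p) (snd p) (tangent_map (prod_atlas A B) A fst p u)
    (tangent_map (prod_atlas A B) B snd p u) = u"
proof -
  have p': "fst p \<in> points A" "snd p \<in> points B" using p by (auto simp: points_prod_atlas)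
  have "(tangent_map (prod_atlas A B) A fst p u (chart_at A (fst p)),
     tangent_map (prod_atlas A B) B snd p u (chart_at B (snd p))) =
     u (prod_chart (chart_at A (fst p)) (chart_at B (snd p)))"
    using tangent_map_proj_component[OF A chart_at[OF p'(1)] B chart_at[OF p'(2)], of u] u
    by (simp add: prod_eq_iff)
  then show ?thesis
    using tpair_eq_coord_vec[OF A chart_at[OF p'(1)] B chart_at[OF p'(2)]]
      tangent_map_proj_in_tangent_space[OF A B p u]
      coord_vec_component[OF smooth_atlas_prod_atlas[OF A B], of _ p u] u
      prod_chart_in_prod_atlas[OF chart_at(1)[OF p'(1)] chart_at(1)[OF p'(2)]]
      chart_at[OF p'(1)] chart_at[OF p'(2)] by (simp add: mem_Times_iff)
qed

section \<open>One-forms and the exterior derivative\<close>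

definition form1_coeff ::
    "('m, 'e::euclidean_space) atlas \<Rightarrow> ('m, 'e) form1 \<Rightarrow> ('m, 'e) chart \<Rightarrow> 'e \<Rightarrow> 'e \<Rightarrow> real" where
  "form1_coeff A \<alpha> c u x = \<alpha> (chart_inv c x) (coord_vec A c (chart_inv c x) u)"

definition pullback1 ::
    "('m, 'e::euclidean_space) atlas \<Rightarrow> ('n, 'f::euclidean_space) atlas \<Rightarrow> ('m \<Rightarrow> 'n)
      \<Rightarrow> ('n, 'f) form1 \<Rightarrow> ('m, 'e) form1" where
  "pullback1 A B f \<alpha> = (\<lambda>p v. \<alpha> (f p) (tangent_map A B f p v))"

lemma ext_deriv_form1_coeff:
  "ext_deriv A \<alpha> p v w =
    fderiv (form1_coeff A \<alpha> (chart_at A p) (w (chart_at A p))) (chart_map (chart_at A p) p) (v (chart_at A p))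
    - fderiv (form1_coeff A \<alpha> (chart_at A p) (v (chart_at A p))) (chart_map (chart_at A p) p) (w (chart_at A p))"
  by (simp add: ext_deriv_def Let_def form1_coeff_def[abs_def])

lemma smooth_form1_coeff:
  assumes "smooth_form1 A \<alpha>" "c \<in> A"
  shows "smooth_on (chart_map c ` chart_dom c) (form1_coeff A \<alpha> c u)"
  using assms unfolding smooth_form1_def form1_coeff_def[abs_def] by blast

lemma smooth_form1_linear: "smooth_form1 A \<alpha> \<Longrightarrow> p \<in> points A \<Longrightarrow> linear_on_tangent A p (\<alpha> p)"
  unfolding smooth_form1_def by blast

lemma smooth_form1I:
  assumes "\<And>p. p \<in> points A \<Longrightarrow> linear_on_tangent A p (\<alpha> p)"
    and "\<And>c u. c \<in> A \<Longrightarrow> smooth_on (chart_map c ` chart_dom c) (form1_coeff A \<alpha> c u)"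
  shows "smooth_form1 A \<alpha>"
  using assms unfolding smooth_form1_def form1_coeff_def[abs_def] by blast

lemma linear_on_tangentD:
  assumes "linear_on_tangent A p \<alpha>" "v \<in> tangent_space A p"
  shows "w \<in> tangent_space A p \<Longrightarrow> \<alpha> (tadd v w) = \<alpha> v + \<alpha> w" "\<alpha> (tscale r v) = r * \<alpha> v"
  using assms unfolding linear_on_tangent_def by auto

lemma linear_on_tangentI:
  assumes "\<And>v w. v \<in> tangent_space A p \<Longrightarrow> w \<in> tangent_space A p \<Longrightarrow> \<alpha> (tadd v w) = \<alpha> v + \<alpha> w"
    and "\<And>r v. v \<in> tangent_space A p \<Longrightarrow> \<alpha> (tscale r v) = r * \<alpha> v"
  shows "linear_on_tangent A p \<alpha>"
  using assms unfolding linear_on_tangent_def by blast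

lemma linear_covector_coords:
  assumes "smooth_atlas A" "c \<in> A" "p \<in> chart_dom c" "linear_on_tangent A p \<alpha>"
  shows "linear (\<lambda>u. \<alpha> (coord_vec A c p u))"
  using linear_on_tangentD[OF assms(4) coord_vec_in_tangent_space[OF assms(1-3)]]
    coord_vec_in_tangent_space[OF assms(1-3)]
  by (intro linearI) (simp_all add: coord_vec_add[OF assms(1-3)] coord_vec_scale[OF assms(1-3)])

lemma linear_form1_coeff:
  assumes "smooth_atlas A" "smooth_form1 A \<alpha>" "c \<in> A" "x \<in> chart_map c ` chart_dom c"
  shows "linear (\<lambda>u. form1_coeff A \<alpha> c u x)"
proof -
  have q: "chart_inv c x \<in> chart_dom c" by (rule chart_inv_in(1)[OF assms(4)])
  have "chart_inv c x \<in> points A" using q chart_dom_subset_points[OF assms(3)] by blast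
  then show ?thesis
    unfolding form1_coeff_def
    by (intro linear_covector_coords[OF assms(1,3) q] smooth_form1_linear[OF assms(2)])
qed

lemma form1_coeff_expand:
  assumes "smooth_atlas A" "smooth_form1 A \<alpha>" "c \<in> A" "x \<in> chart_map c ` chart_dom c"
  shows "form1_coeff A \<alpha> c u x = (\<Sum>b\<in>Basis. (u \<bullet> b) * form1_coeff A \<alpha> c b x)"
  using linear_expand_Basis[OF linear_form1_coeff[OF assms], of u] by (simp only: real_scaleR_def)

text \<open>The exterior derivative commutes with pullbacks. In charts, with \<open>\<phi>\<close> the local expression of
  the map and \<open>a\<^sub>b\<close> the coefficients of the form, the pullback has the coefficient
  \<open>\<Sum>b. (\<phi>'(x) u \<bullet> b) a\<^sub>b (\<phi> x)\<close> in direction \<open>u\<close>. Differentiating it along \<open>h\<close> gives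
  one term with the second derivative of \<open>\<phi>\<close>, which is symmetric in \<open>u\<close> and \<open>h\<close> and
  drops out of the antisymmetrization, and one term that is the derivative of the original form.\<close>

lemma ext_deriv_pullback1:
  fixes A :: "('m, 'e::euclidean_space) atlas" and B :: "('n, 'f::euclidean_space) atlas"
  assumes A: "smooth_atlas A" and B: "smooth_atlas B" and f: "smooth_map_on A B W f"
    and p: "p \<in> W" "p \<in> points A" and \<alpha>: "smooth_form1 B \<alpha>"
  shows "ext_deriv A (pullback1 A B f \<alpha>) p v w
    = ext_deriv B \<alpha> (f p) (tangent_map A B f p v) (tangent_map A B f p w)"
proof -
  define c where "c = chart_at A p"
  define d where "d = chart_at B (f p)"
  define \<phi> where "\<phi> = chart_map d \<circ> f \<circ> chart_inv c"
  define S where "S = chart_map c ` {q \<in> chart_dom c \<inter> W. f q \<in> chart_dom d}"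
  define T where "T = chart_map d ` chart_dom d"
  define x0 where "x0 = chart_map c p"
  have fp: "f p \<in> points B" using f p(1) unfolding smooth_map_on_def by blast
  have c: "c \<in> A" "p \<in> chart_dom c" and d: "d \<in> B" "f p \<in> chart_dom d"
    using chart_at[OF p(2)] chart_at[OF fp] by (auto simp: c_def d_def)
  have S: "open S" and \<phi>: "smooth_on S \<phi>"
    unfolding S_def \<phi>_def by (rule smooth_map_onD[OF f c(1) d(1)])+
  have T: "open T" unfolding T_def by (rule open_chart_image[OF B d(1)])
  have x0: "x0 \<in> S" using c d p by (auto simp: x0_def S_def)
  have \<phi>x0: "\<phi> x0 = chart_map d (f p)" using chart_inv_map[OF A c] by (simp add: \<phi>_def x0_def)
  have y0: "\<phi> x0 \<in> T" using d by (simp add: \<phi>x0 T_def)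
  let ?a = "form1_coeff B \<alpha> d"
  have a: "(?a b has_derivative fderiv (?a b) (\<phi> x0)) (at (\<phi> x0))" for b
    using smooth_on_imp_has_derivative[OF smooth_form1_coeff[OF \<alpha> d(1)]] y0 unfolding T_def by blast
  have dphi: "(\<phi> has_derivative fderiv \<phi> x0) (at x0)"
    by (rule smooth_on_imp_has_derivative[OF \<phi> x0])
  have coeff: "form1_coeff A (pullback1 A B f \<alpha>) c u x = (\<Sum>b\<in>Basis. (fderiv \<phi> x u \<bullet> b) * ?a b (\<phi> x))"
    if x: "x \<in> S" for u x
  proof -
    obtain q where q: "q \<in> chart_dom c" "q \<in> W" "f q \<in> chart_dom d" "x = chart_map c q"
      using x unfolding S_def by blast
    have inv: "chart_inv c x = q" using chart_inv_map[OF A c(1) q(1)] q(4) by simp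
    have \<phi>x: "\<phi> x = chart_map d (f q)" by (simp add: \<phi>_def inv)
    have "form1_coeff A (pullback1 A B f \<alpha>) c u x = ?a (fderiv \<phi> x u) (\<phi> x)"
      unfolding form1_coeff_def pullback1_def inv \<phi>x chart_inv_map[OF B d(1) q(3)]
      unfolding tangent_map_coord_vec[OF A B f q(2) c(1) q(1) d(1) q(3)] \<phi>_def q(4) ..
    also have "\<dots> = (\<Sum>b\<in>Basis. (fderiv \<phi> x u \<bullet> b) * ?a b (\<phi> x))"
      by (rule form1_coeff_expand[OF B \<alpha> d(1)]) (use q \<phi>x in auto)
    finally show ?thesis .
  qed
  have deriv_pullback: "fderiv (form1_coeff A (pullback1 A B f \<alpha>) c u) x0 h
      = (\<Sum>b\<in>Basis. (fderiv \<phi> x0 u \<bullet> b) * fderiv (?a b) (\<phi> x0) (fderiv \<phi> x0 h))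
        + (\<Sum>b\<in>Basis. (fderiv (\<lambda>x. fderiv \<phi> x u) x0 h \<bullet> b) * ?a b (\<phi> x0))" for u h
  proof -
    have "((\<lambda>x. fderiv \<phi> x u) has_derivative fderiv (\<lambda>x. fderiv \<phi> x u) x0) (at x0)"
      by (rule smooth_on_imp_has_derivative[OF smooth_on_fderiv[OF \<phi>] x0])
    then have 1: "((\<lambda>x. fderiv \<phi> x u \<bullet> b) has_derivative (\<lambda>h. fderiv (\<lambda>x. fderiv \<phi> x u) x0 h \<bullet> b)) (at x0)"
      for b by (rule has_derivative_inner_left)
    have 2: "((\<lambda>x. ?a b (\<phi> x)) has_derivative (\<lambda>h. fderiv (?a b) (\<phi> x0) (fderiv \<phi> x0 h))) (at x0)" for b
      by (rule has_derivative_compose[OF dphi a])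
    have "((\<lambda>x. \<Sum>b\<in>Basis. (fderiv \<phi> x u \<bullet> b) * ?a b (\<phi> x)) has_derivative
        (\<lambda>h. \<Sum>b\<in>Basis. (fderiv \<phi> x0 u \<bullet> b) * fderiv (?a b) (\<phi> x0) (fderiv \<phi> x0 h)
          + (fderiv (\<lambda>x. fderiv \<phi> x u) x0 h \<bullet> b) * ?a b (\<phi> x0))) (at x0)"
      by (rule has_derivative_sum, rule has_derivative_mult[OF 1 2])
    then have "(form1_coeff A (pullback1 A B f \<alpha>) c u has_derivative
        (\<lambda>h. \<Sum>b\<in>Basis. (fderiv \<phi> x0 u \<bullet> b) * fderiv (?a b) (\<phi> x0) (fderiv \<phi> x0 h)
          + (fderiv (\<lambda>x. fderiv \<phi> x u) x0 h \<bullet> b) * ?a b (\<phi> x0))) (at x0)"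
      by (rule has_derivative_transform_within_open[OF _ S x0]) (simp add: coeff)
    from fderiv_eqI[OF this] show ?thesis by (simp add: sum.distrib)
  qed
  have deriv_coeff: "fderiv (?a e) (\<phi> x0) k = (\<Sum>b\<in>Basis. (e \<bullet> b) * fderiv (?a b) (\<phi> x0) k)" for e k
  proof -
    have "((\<lambda>y. \<Sum>b\<in>Basis. (e \<bullet> b) * ?a b y) has_derivative
        (\<lambda>k. \<Sum>b\<in>Basis. (e \<bullet> b) * fderiv (?a b) (\<phi> x0) k)) (at (\<phi> x0))"
      by (rule has_derivative_sum, rule has_derivative_mult_right[OF a])
    then have "(?a e has_derivative (\<lambda>k. \<Sum>b\<in>Basis. (e \<bullet> b) * fderiv (?a b) (\<phi> x0) k)) (at (\<phi> x0))"
      by (rule has_derivative_transform_within_open[OF _ T y0])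
         (rule form1_coeff_expand[OF B \<alpha> d(1), symmetric], simp add: T_def)
    from fderiv_eqI[OF this] show ?thesis by simp
  qed
  have tm: "tangent_map A B f p z d = fderiv \<phi> x0 (z c)" for z
    using d by (simp add: tangent_map_def Let_def c_def[symmetric] \<phi>_def x0_def)
  have sym: "fderiv (\<lambda>x. fderiv \<phi> x (w c)) x0 (v c) = fderiv (\<lambda>x. fderiv \<phi> x (v c)) x0 (w c)"
    by (rule second_derivative_symmetric[OF S x0 \<phi>])
  show ?thesis
    unfolding ext_deriv_form1_coeff c_def[symmetric] d_def[symmetric] x0_def[symmetric] \<phi>x0[symmetric]
      tm deriv_pullback deriv_coeff[of "fderiv \<phi> x0 _"] sym by simp
qed

text \<open>The exterior derivative is local; it suffices that the two forms agree on actual tangent vectors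
  over a neighbourhood.\<close>

lemma ext_deriv_cong:
  assumes A: "smooth_atlas A" and W: "atlas_open A W" "p \<in> W" and \<alpha>: "smooth_form1 A \<alpha>"
    and eq: "\<And>q u. q \<in> W \<Longrightarrow> u \<in> tangent_space A q \<Longrightarrow> \<alpha> q u = \<alpha>' q u"
  shows "ext_deriv A \<alpha> p v w = ext_deriv A \<alpha>' p v w"
proof -
  define c where "c = chart_at A p"
  have pA: "p \<in> points A" using W unfolding atlas_open_def by blast
  have c: "c \<in> A" "p \<in> chart_dom c" using chart_at[OF pA] by (auto simp: c_def)
  have "fderiv (form1_coeff A \<alpha> c u) (chart_map c p) = fderiv (form1_coeff A \<alpha>' c u) (chart_map c p)" for u
  proof (rule fderiv_cong_open)
    show "open (chart_map c ` (chart_dom c \<inter> W))" using W c unfolding atlas_open_def by blast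
    show "chart_map c p \<in> chart_map c ` (chart_dom c \<inter> W)" using W c by blast
    show "form1_coeff A \<alpha> c u differentiable (at (chart_map c p))"
      using smooth_on_imp_differentiable[OF smooth_form1_coeff[OF \<alpha> c(1)]] c by blast
    fix x assume "x \<in> chart_map c ` (chart_dom c \<inter> W)"
    then obtain q where "q \<in> chart_dom c" "q \<in> W" "x = chart_map c q" by blast
    then show "form1_coeff A \<alpha> c u x = form1_coeff A \<alpha>' c u x"
      using eq coord_vec_in_tangent_space[OF A c(1)] chart_inv_map[OF A c(1)]
      by (simp add: form1_coeff_def)
  qed
  then show ?thesis unfolding ext_deriv_form1_coeff c_def by simp
qed

lemma atlas_open_points:
  assumes "smooth_atlas A"
  shows "atlas_open A (points A)"
  unfolding atlas_open_def
proof (intro conjI ballI)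
  fix c assume "c \<in> A"
  then show "open (chart_map c ` (chart_dom c \<inter> points A))"
    using open_chart_image[OF assms] chart_dom_subset_points[of c A] by (simp add: Int_absorb2)
qed simp

lemma form1_coeff_diff: "form1_coeff A (\<lambda>p v. \<alpha> p v - \<beta> p v) c u = (\<lambda>x. form1_coeff A \<alpha> c u x - form1_coeff A \<beta> c u x)"
  and form1_coeff_add: "form1_coeff A (\<lambda>p v. \<alpha> p v + \<beta> p v) c u = (\<lambda>x. form1_coeff A \<alpha> c u x + form1_coeff A \<beta> c u x)"
  by (auto simp: form1_coeff_def)

lemma smooth_form1_diff:
  assumes "smooth_atlas A" "smooth_form1 A \<alpha>" "smooth_form1 A \<beta>"
  shows "smooth_form1 A (\<lambda>p v. \<alpha> p v - \<beta> p v)"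
proof (rule smooth_form1I)
  fix p assume p: "p \<in> points A"
  show "linear_on_tangent A p (\<lambda>v. \<alpha> p v - \<beta> p v)"
    using smooth_form1_linear[OF assms(2) p] smooth_form1_linear[OF assms(3) p]
    by (intro linear_on_tangentI) (simp_all add: linear_on_tangentD algebra_simps)
next
  fix c u assume "c \<in> A"
  then show "smooth_on (chart_map c ` chart_dom c) (form1_coeff A (\<lambda>p v. \<alpha> p v - \<beta> p v) c u)"
    unfolding form1_coeff_diff using assms
    by (intro smooth_on_diff open_chart_image smooth_form1_coeff)
qed

lemma smooth_form1_add:
  assumes "smooth_atlas A" "smooth_form1 A \<alpha>" "smooth_form1 A \<beta>"
  shows "smooth_form1 A (\<lambda>p v. \<alpha> p v + \<beta> p v)"
proof (rule smooth_form1I)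
  fix p assume p: "p \<in> points A"
  show "linear_on_tangent A p (\<lambda>v. \<alpha> p v + \<beta> p v)"
    using smooth_form1_linear[OF assms(2) p] smooth_form1_linear[OF assms(3) p]
    by (intro linear_on_tangentI) (simp_all add: linear_on_tangentD algebra_simps)
next
  fix c u assume "c \<in> A"
  then show "smooth_on (chart_map c ` chart_dom c) (form1_coeff A (\<lambda>p v. \<alpha> p v + \<beta> p v) c u)"
    unfolding form1_coeff_add using assms
    by (intro smooth_on_add open_chart_image smooth_form1_coeff)
qed

lemma ext_deriv_diff:
  assumes "p \<in> points A" "smooth_form1 A \<alpha>" "smooth_form1 A \<beta>"
  shows "ext_deriv A (\<lambda>p v. \<alpha> p v - \<beta> p v) p v w = ext_deriv A \<alpha> p v w - ext_deriv A \<beta> p v w"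
proof -
  define c where "c = chart_at A p"
  have c: "c \<in> A" "p \<in> chart_dom c" using chart_at[OF assms(1)] by (auto simp: c_def)
  have "(form1_coeff A \<gamma> c u has_derivative fderiv (form1_coeff A \<gamma> c u) (chart_map c p)) (at (chart_map c p))"
    if "smooth_form1 A \<gamma>" for \<gamma> u
    by (rule smooth_on_imp_has_derivative[OF smooth_form1_coeff[OF that c(1)]]) (use c in blast)
  then have "fderiv (form1_coeff A (\<lambda>p v. \<alpha> p v - \<beta> p v) c u) (chart_map c p)
      = (\<lambda>h. fderiv (form1_coeff A \<alpha> c u) (chart_map c p) h - fderiv (form1_coeff A \<beta> c u) (chart_map c p) h)" for u
    unfolding form1_coeff_diff using assms by (intro fderiv_eqI has_derivative_diff)
  then show ?thesis unfolding ext_deriv_form1_coeff c_def by simp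
qed

lemma smooth_functionD:
  assumes "smooth_function A H" "c \<in> A"
  shows "smooth_on (chart_map c ` chart_dom c) (H \<circ> chart_inv c)"
  using assms unfolding smooth_function_def by blast

lemma differential_component:
  assumes A: "smooth_atlas A" and H: "smooth_function A H" and c: "c \<in> A" "p \<in> chart_dom c"
    and v: "v \<in> tangent_space A p"
  shows "differential A H p v = fderiv (H \<circ> chart_inv c) (chart_map c p) (v c)"
proof -
  have pA: "p \<in> points A" using c chart_dom_subset_points by blast
  define d where "d = chart_at A p"
  have d: "d \<in> A" "p \<in> chart_dom d" using chart_at[OF pA] by (auto simp: d_def)
  let ?S = "chart_map c ` (chart_dom c \<inter> chart_dom d)" and ?t = "chart_map d \<circ> chart_inv c"
  have x: "chart_map c p \<in> ?S" using c d by blast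
  have tx: "?t (chart_map c p) = chart_map d p" using chart_inv_map[OF A c] by simp
  have dt: "(?t has_derivative fderiv ?t (chart_map c p)) (at (chart_map c p))"
    by (rule smooth_on_imp_has_derivative[OF smooth_transition[OF A c(1) d(1)] x])
  have dH: "((H \<circ> chart_inv d) has_derivative fderiv (H \<circ> chart_inv d) (chart_map d p)) (at (?t (chart_map c p)))"
    unfolding tx by (rule smooth_on_imp_has_derivative[OF smooth_functionD[OF H d(1)]]) (use d in blast)
  have "((\<lambda>x. (H \<circ> chart_inv d) (?t x)) has_derivative
      (\<lambda>u. fderiv (H \<circ> chart_inv d) (chart_map d p) (fderiv ?t (chart_map c p) u))) (at (chart_map c p))"
    by (rule has_derivative_compose[OF dt dH])
  then have "((H \<circ> chart_inv c) has_derivative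
      (\<lambda>u. fderiv (H \<circ> chart_inv d) (chart_map d p) (fderiv ?t (chart_map c p) u))) (at (chart_map c p))"
    by (rule has_derivative_transform_within_open[OF _ open_chart_overlap[OF A c(1) d(1)] x])
       (auto simp: chart_inv_map[OF A c(1)] chart_inv_map[OF A d(1)])
  from fderiv_eqI[OF this] show ?thesis
    using tangent_space_change[OF v c(1) d(1) c(2) d(2)]
    by (simp add: differential_def Let_def d_def)
qed

text \<open>The coefficients of a differential are first derivatives, so the exterior derivative of a
  differential is a difference of mixed second derivatives.\<close>

lemma form1_coeff_differential:
  assumes "smooth_atlas A" "smooth_function A H" "c \<in> A" "x \<in> chart_map c ` chart_dom c"
  shows "form1_coeff A (differential A H) c u x = fderiv (H \<circ> chart_inv c) x u"
proof -
  have q: "chart_inv c x \<in> chart_dom c" "chart_map c (chart_inv c x) = x"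
    using chart_inv_in[OF assms(4)] by auto
  show ?thesis
    using differential_component[OF assms(1-3) q(1) coord_vec_in_tangent_space[OF assms(1,3) q(1)]]
    by (simp add: form1_coeff_def coord_vec_same[OF assms(1,3) q(1)] q(2))
qed

lemma smooth_form1_differential:
  assumes A: "smooth_atlas A" and H: "smooth_function A H"
  shows "smooth_form1 A (differential A H)"
proof (rule smooth_form1I)
  fix p assume "p \<in> points A"
  note c = chart_at[OF this]
  have "linear (fderiv (H \<circ> chart_inv (chart_at A p)) (chart_map (chart_at A p) p))"
    by (rule smooth_on_imp_linear[OF smooth_functionD[OF H c(1)]]) (use c in blast)
  from linear_add[OF this] linear_cmul[OF this] show "linear_on_tangent A p (differential A H p)"
    by (intro linear_on_tangentI) (simp_all add: differential_def Let_def tadd_def tscale_def)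
next
  fix c u assume c: "c \<in> A"
  show "smooth_on (chart_map c ` chart_dom c) (form1_coeff A (differential A H) c u)"
    by (rule smooth_on_eq[OF open_chart_image[OF A c] smooth_on_fderiv[OF smooth_functionD[OF H c]]])
       (rule form1_coeff_differential[OF A H c])
qed

lemma ext_deriv_differential:
  assumes A: "smooth_atlas A" and H: "smooth_function A H" and p: "p \<in> points A"
  shows "ext_deriv A (differential A H) p v w = 0"
proof -
  define c where "c = chart_at A p"
  have c: "c \<in> A" "p \<in> chart_dom c" using chart_at[OF p] by (auto simp: c_def)
  let ?h = "H \<circ> chart_inv c"
  note S = open_chart_image[OF A c(1)] and h = smooth_functionD[OF H c(1)]
  have x: "chart_map c p \<in> chart_map c ` chart_dom c" using c by blast
  have "fderiv (\<lambda>x. fderiv ?h x u) (chart_map c p) = fderiv (form1_coeff A (differential A H) c u) (chart_map c p)" for u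
    by (rule fderiv_cong_open[OF S x])
       (use form1_coeff_differential[OF A H c(1)] smooth_on_imp_differentiable[OF smooth_on_fderiv[OF h] x] in auto)
  then show ?thesis
    using second_derivative_symmetric[OF S x h]
    unfolding ext_deriv_form1_coeff c_def[symmetric] by (metis diff_self)
qed

section \<open>The cotangent bundle and its canonical one-form\<close>

definition covec_coords ::
    "('m, 'e::euclidean_space) atlas \<Rightarrow> ('m, 'e) chart \<Rightarrow> 'm \<Rightarrow> ('m, 'e) covec \<Rightarrow> 'e" where
  "covec_coords A c q \<alpha> = (\<Sum>b\<in>Basis. \<alpha> (coord_vec A c q b) *\<^sub>R b)"

definition covec_of_coords ::
    "('m, 'e::euclidean_space) atlas \<Rightarrow> ('m, 'e) chart \<Rightarrow> 'm \<Rightarrow> 'e \<Rightarrow> ('m, 'e) covec" where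
  "covec_of_coords A c q \<xi> = (\<lambda>v\<in>tangent_space A q. v c \<bullet> \<xi>)"

lemma chart_dom_cotangent_chart [simp]:
    "chart_dom (cotangent_chart A c) = Sigma (chart_dom c) (cotangent_space A)"
  and chart_map_cotangent_chart [simp]:
    "chart_map (cotangent_chart A c) = (\<lambda>(q, \<alpha>). (chart_map c q, covec_coords A c q \<alpha>))"
  by (auto simp: cotangent_chart_def covec_coords_def)

lemma in_cotangent_bundle_iff: "C \<in> cotangent_bundle A \<longleftrightarrow> (\<exists>c\<in>A. C = cotangent_chart A c)"
  unfolding cotangent_bundle_def by blast

lemma points_cotangent_bundle: "points (cotangent_bundle A) = Sigma (points A) (cotangent_space A)"
proof (rule set_eqI)
  fix P
  have "P \<in> points (cotangent_bundle A) \<longleftrightarrow> (\<exists>c\<in>A. P \<in> chart_dom (cotangent_chart A c))"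
    unfolding points_def cotangent_bundle_def by blast
  also have "\<dots> \<longleftrightarrow> P \<in> Sigma (points A) (cotangent_space A)"
    unfolding points_def chart_dom_cotangent_chart mem_Sigma_iff[of "fst P" "snd P", simplified] by blast
  finally show "P \<in> points (cotangent_bundle A) \<longleftrightarrow> P \<in> Sigma (points A) (cotangent_space A)" .
qed

lemma cotangent_spaceD: "\<alpha> \<in> cotangent_space A q \<Longrightarrow> linear_on_tangent A q \<alpha>"
  unfolding cotangent_space_def by blast

text \<open>The coordinate vector of a covector represents it through the inner product. This identifies each
  cotangent space with the model space and gives the charts of the bundle.\<close>

lemma covec_coords_inner:
  assumes "smooth_atlas A" "c \<in> A" "q \<in> chart_dom c" "linear_on_tangent A q \<alpha>"
  shows "\<alpha> (coord_vec A c q u) = u \<bullet> covec_coords A c q \<alpha>"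
  using linear_expand_Basis[OF linear_covector_coords[OF assms], of u]
  by (simp add: covec_coords_def inner_sum_right mult.commute)

lemma covec_of_coords_in_cotangent_space:
  assumes "smooth_atlas A" "c \<in> A" "q \<in> chart_dom c"
  shows "covec_of_coords A c q \<xi> \<in> cotangent_space A q"
  unfolding cotangent_space_def
proof (intro CollectI conjI linear_on_tangentI)
  fix v w r assume "v \<in> tangent_space A q" "w \<in> tangent_space A q"
  then show "covec_of_coords A c q \<xi> (tadd v w) = covec_of_coords A c q \<xi> v + covec_of_coords A c q \<xi> w"
    using tadd_in_tangent_space[OF assms(1)]
    by (simp add: covec_of_coords_def) (simp add: tadd_def inner_add_left)
next
  fix v r assume "v \<in> tangent_space A q"
  then show "covec_of_coords A c q \<xi> (tscale r v) = r * covec_of_coords A c q \<xi> v"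
    using tscale_in_tangent_space[OF assms(1)]
    by (simp add: covec_of_coords_def) (simp add: tscale_def)
qed (simp add: covec_of_coords_def)

lemma covec_coords_of_coords:
  assumes "smooth_atlas A" "c \<in> A" "q \<in> chart_dom c"
  shows "covec_coords A c q (covec_of_coords A c q \<xi>) = \<xi>"
  using coord_vec_in_tangent_space[OF assms] coord_vec_same[OF assms]
  by (simp add: covec_coords_def covec_of_coords_def inner_commute[of _ \<xi>] euclidean_representation)

lemma covec_of_coords_coords:
  assumes "smooth_atlas A" "c \<in> A" "q \<in> chart_dom c" "\<alpha> \<in> cotangent_space A q"
  shows "covec_of_coords A c q (covec_coords A c q \<alpha>) = \<alpha>"
proof (rule extensionalityI)
  show "covec_of_coords A c q (covec_coords A c q \<alpha>) \<in> extensional (tangent_space A q)"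
    by (simp add: covec_of_coords_def)
  show "\<alpha> \<in> extensional (tangent_space A q)" using assms(4) by (simp add: cotangent_space_def)
  fix v assume "v \<in> tangent_space A q"
  then show "covec_of_coords A c q (covec_coords A c q \<alpha>) v = \<alpha> v"
    using covec_coords_inner[OF assms(1-3) cotangent_spaceD[OF assms(4)], of "v c"]
      coord_vec_component[OF assms(1-3)] by (simp add: covec_of_coords_def)
qed

lemma inj_on_cotangent_chart:
  assumes A: "smooth_atlas A" "c \<in> A"
  shows "inj_on (chart_map (cotangent_chart A c)) (chart_dom (cotangent_chart A c))"
proof (rule inj_onI)
  fix P P' assume P: "P \<in> chart_dom (cotangent_chart A c)" "P' \<in> chart_dom (cotangent_chart A c)"
    and eq: "chart_map (cotangent_chart A c) P = chart_map (cotangent_chart A c) P'"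
  obtain q \<alpha> q' \<alpha>' where PP: "P = (q, \<alpha>)" "P' = (q', \<alpha>')" by (cases P, cases P')
  have q: "q \<in> chart_dom c" "q' \<in> chart_dom c" "\<alpha> \<in> cotangent_space A q" "\<alpha>' \<in> cotangent_space A q'"
    and eq': "chart_map c q = chart_map c q'" "covec_coords A c q \<alpha> = covec_coords A c q' \<alpha>'"
    using P eq by (auto simp: PP)
  have "q = q'" using chart_inv_map[OF A q(1)] chart_inv_map[OF A q(2)] eq'(1) by metis
  then show "P = P'"
    using covec_of_coords_coords[OF A q(1,3)] covec_of_coords_coords[OF A q(2,4)] eq'(2) PP by metis
qed

lemma cotangent_chart_image:
  assumes A: "smooth_atlas A" "c \<in> A" and S: "S \<subseteq> chart_dom c"
  shows "chart_map (cotangent_chart A c) ` Sigma S (cotangent_space A) = chart_map c ` S \<times> UNIV"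
proof
  show "chart_map c ` S \<times> UNIV \<subseteq> chart_map (cotangent_chart A c) ` Sigma S (cotangent_space A)"
  proof
    fix z assume "z \<in> chart_map c ` S \<times> (UNIV :: 'b set)"
    then obtain q where q: "q \<in> S" "fst z = chart_map c q" by auto
    have "z = chart_map (cotangent_chart A c) (q, covec_of_coords A c q (snd z))"
      using covec_coords_of_coords[OF A, of q] q S by (auto simp: prod_eq_iff)
    then show "z \<in> chart_map (cotangent_chart A c) ` Sigma S (cotangent_space A)"
      by (rule image_eqI) (use covec_of_coords_in_cotangent_space[OF A] q S in auto)
  qed
qed auto

lemma chart_inv_cotangent_chart:
  assumes A: "smooth_atlas A" "c \<in> A" and x: "x \<in> chart_map c ` chart_dom c"
  shows "chart_inv (cotangent_chart A c) (x, \<xi>) = (chart_inv c x, covec_of_coords A c (chart_inv c x) \<xi>)"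
proof (rule inv_into_f_eq[OF inj_on_cotangent_chart[OF A]])
  note q = chart_inv_in[OF x]
  show "(chart_inv c x, covec_of_coords A c (chart_inv c x) \<xi>) \<in> chart_dom (cotangent_chart A c)"
    using covec_of_coords_in_cotangent_space[OF A q(1)] q by simp
  show "chart_map (cotangent_chart A c) (chart_inv c x, covec_of_coords A c (chart_inv c x) \<xi>) = (x, \<xi>)"
    using covec_coords_of_coords[OF A q(1)] q by simp
qed

text \<open>Covectors transform by the transpose of the derivative of the inverse coordinate change.\<close>

lemma covec_coords_change:
  assumes A: "smooth_atlas A" and c: "c \<in> A" "q \<in> chart_dom c" and d: "d \<in> A" "q \<in> chart_dom d"
  shows "covec_coords A d q (covec_of_coords A c q \<xi>) =
    (\<Sum>b\<in>Basis. (fderiv (chart_map c \<circ> chart_inv d) (chart_map d q) b \<bullet> \<xi>) *\<^sub>R b)"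
  using coord_vec_in_tangent_space[OF A d] c
  by (simp add: covec_coords_def covec_of_coords_def) (simp add: coord_vec_def)

lemma smooth_atlas_cotangent_bundle:
  fixes A :: "('m, 'e::euclidean_space) atlas"
  assumes A: "smooth_atlas A"
  shows "smooth_atlas (cotangent_bundle A)"
  unfolding smooth_atlas_def
proof (intro conjI ballI)
  fix C assume "C \<in> cotangent_bundle A"
  then show "inj_on (chart_map C) (chart_dom C)"
    unfolding in_cotangent_bundle_iff using inj_on_cotangent_chart[OF A] by blast
next
  fix C D assume "C \<in> cotangent_bundle A" "D \<in> cotangent_bundle A"
  then obtain c d where C: "C = cotangent_chart A c" and D: "D = cotangent_chart A d"
    and c: "c \<in> A" and d: "d \<in> A"
    unfolding in_cotangent_bundle_iff by blast
  let ?S = "chart_map c ` (chart_dom c \<inter> chart_dom d)" and ?U = "UNIV :: 'e set"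
  have "chart_dom C \<inter> chart_dom D = Sigma (chart_dom c \<inter> chart_dom d) (cotangent_space A)"
    by (auto simp: C D)
  then have img: "chart_map C ` (chart_dom C \<inter> chart_dom D) = ?S \<times> ?U"
    using cotangent_chart_image[OF A c, of "chart_dom c \<inter> chart_dom d"] by (simp only: C Int_lower1)
  have S: "open ?S" by (rule open_chart_overlap[OF A c d])
  have SU: "open (?S \<times> ?U)" using S by (simp add: open_Times)
  then show "open (chart_map C ` (chart_dom C \<inter> chart_dom D))" unfolding img .
  let ?t = "chart_map d \<circ> chart_inv c" and ?J = "\<lambda>y b. fderiv (chart_map c \<circ> chart_inv d) y b"
  have "?t ` ?S \<subseteq> chart_map d ` (chart_dom d \<inter> chart_dom c)"
    using chart_inv_map[OF A c] by auto
  from smooth_on_compose[OF S open_chart_overlap[OF A d c] this smooth_transition[OF A c d]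
      smooth_on_fderiv[OF smooth_transition[OF A d c]]]
  have J: "smooth_on ?S (\<lambda>x. ?J (?t x) b)" for b .
  have "smooth_on (?S \<times> ?U) (\<lambda>z. (?t (fst z), \<Sum>b\<in>Basis. (?J (?t (fst z)) b \<bullet> snd z) *\<^sub>R b))"
  proof (rule smooth_on_Pair[OF SU smooth_on_fst[OF S open_UNIV smooth_transition[OF A c d]]],
      rule smooth_on_sum[OF SU], rule smooth_on_scaleR[OF SU smooth_on_inner[OF SU _ ] smooth_on_const])
    show "smooth_on (?S \<times> ?U) (\<lambda>z. ?J (?t (fst z)) b)" for b
      by (rule smooth_on_fst[OF S open_UNIV J])
    show "smooth_on (?S \<times> ?U) snd"
      by (rule smooth_on_bounded_linear[OF SU bounded_linear_snd smooth_on_ident])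
  qed
  then show "smooth_on (chart_map C ` (chart_dom C \<inter> chart_dom D)) (chart_map D \<circ> chart_inv C)"
    unfolding img
  proof (rule smooth_on_eq[OF SU])
    fix z assume "z \<in> ?S \<times> ?U"
    then obtain q \<xi> where q: "q \<in> chart_dom c" "q \<in> chart_dom d" and z: "z = (chart_map c q, \<xi>)" by auto
    have "chart_inv C z = (q, covec_of_coords A c q \<xi>)"
      using chart_inv_cotangent_chart[OF A c, of "chart_map c q" \<xi>] q chart_inv_map[OF A c q(1)]
      by (simp add: C z)
    then show "(chart_map D \<circ> chart_inv C) z = (?t (fst z), \<Sum>b\<in>Basis. (?J (?t (fst z)) b \<bullet> snd z) *\<^sub>R b)"
      using covec_coords_change[OF A c q(1) d q(2)] chart_inv_map[OF A c q(1)] by (simp add: D z)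
  qed
qed

lemma smooth_map_on_cotangent_projection:
  fixes A :: "('m, 'e::euclidean_space) atlas"
  assumes A: "smooth_atlas A"
  shows "smooth_map_on (cotangent_bundle A) A (points (cotangent_bundle A)) fst"
  unfolding smooth_map_on_def Let_def
proof (intro conjI ballI)
  show "fst ` points (cotangent_bundle A) \<subseteq> points A" by (auto simp: points_cotangent_bundle)
  fix C d assume "C \<in> cotangent_bundle A" and d: "d \<in> A"
  then obtain c where C: "C = cotangent_chart A c" and c: "c \<in> A"
    unfolding in_cotangent_bundle_iff by blast
  let ?S = "chart_map c ` (chart_dom c \<inter> chart_dom d)" and ?U = "UNIV :: 'e set"
  have "{P \<in> chart_dom C \<inter> points (cotangent_bundle A). fst P \<in> chart_dom d}
      = Sigma (chart_dom c \<inter> chart_dom d) (cotangent_space A)"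
    using chart_dom_subset_points[OF c] by (auto simp: C points_cotangent_bundle)
  then have img: "chart_map C ` {P \<in> chart_dom C \<inter> points (cotangent_bundle A). fst P \<in> chart_dom d}
      = ?S \<times> ?U"
    using cotangent_chart_image[OF A c, of "chart_dom c \<inter> chart_dom d"] by (simp only: C Int_lower1)
  have S: "open ?S" by (rule open_chart_overlap[OF A c d])
  have SU: "open (?S \<times> ?U)" using S by (simp add: open_Times)
  then show "open (chart_map C ` {P \<in> chart_dom C \<inter> points (cotangent_bundle A). fst P \<in> chart_dom d})"
    unfolding img .
  show "smooth_on (chart_map C ` {P \<in> chart_dom C \<inter> points (cotangent_bundle A). fst P \<in> chart_dom d})
      (chart_map d \<circ> fst \<circ> chart_inv C)"
    unfolding img
  proof (rule smooth_on_eq[OF SU smooth_on_fst[OF S open_UNIV smooth_transition[OF A c d]]])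
    fix z assume "z \<in> ?S \<times> ?U"
    then have "fst z \<in> chart_map c ` chart_dom c" by auto
    from chart_inv_cotangent_chart[OF A c this, of "snd z"]
    show "(chart_map d \<circ> fst \<circ> chart_inv C) z = (chart_map d \<circ> chart_inv c) (fst z)"
      by (simp add: C)
  qed
qed

lemma fderiv_local_rep_cotangent_projection:
  fixes A :: "('m, 'e::euclidean_space) atlas"
  assumes A: "smooth_atlas A" "c \<in> A" and x: "x \<in> chart_map c ` chart_dom c"
  shows "fderiv (chart_map c \<circ> fst \<circ> chart_inv (cotangent_chart A c)) (x, \<xi>) = fst"
proof (rule fderiv_eqI, rule has_derivative_transform_within_open)
  show "(fst has_derivative fst) (at (x, \<xi>))" by (auto intro!: derivative_eq_intros)
  show "open (chart_map c ` chart_dom c \<times> (UNIV :: 'e set))" using open_chart_image[OF A] by (simp add: open_Times)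
  fix z :: "'e \<times> 'e" assume "z \<in> chart_map c ` chart_dom c \<times> UNIV"
  then have z: "fst z \<in> chart_map c ` chart_dom c" by auto
  show "fst z = (chart_map c \<circ> fst \<circ> chart_inv (cotangent_chart A c)) z"
    using chart_inv_cotangent_chart[OF A z, of "snd z"] chart_inv_in[OF z] by simp
qed (use x in auto)

text \<open>In bundle coordinates \<open>(x, \<xi>)\<close> the canonical one-form is \<open>\<xi> dx\<close>.\<close>

lemma form1_coeff_canonical_form1:
  fixes A :: "('m, 'e::euclidean_space) atlas"
  assumes A: "smooth_atlas A" "c \<in> A" and x: "x \<in> chart_map c ` chart_dom c"
  shows "form1_coeff (cotangent_bundle A) (canonical_form1 A) (cotangent_chart A c) u (x, \<xi>) = fst u \<bullet> \<xi>"
proof -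
  define q where "q = chart_inv c x"
  define \<alpha> where "\<alpha> = covec_of_coords A c q \<xi>"
  have q: "q \<in> chart_dom c" "chart_map c q = x" using chart_inv_in[OF x] by (auto simp: q_def)
  have \<alpha>: "\<alpha> \<in> cotangent_space A q" "covec_coords A c q \<alpha> = \<xi>"
    unfolding \<alpha>_def by (rule covec_of_coords_in_cotangent_space[OF A q(1)] covec_coords_of_coords[OF A q(1)])+
  have inv: "chart_inv (cotangent_chart A c) (x, \<xi>) = (q, \<alpha>)"
    using chart_inv_cotangent_chart[OF A x] by (simp add: q_def \<alpha>_def)
  have C: "cotangent_chart A c \<in> cotangent_bundle A" "(q, \<alpha>) \<in> chart_dom (cotangent_chart A c)"
    using A(2) q \<alpha> by (auto simp: in_cotangent_bundle_iff)
  have P: "(q, \<alpha>) \<in> points (cotangent_bundle A)" using C chart_dom_subset_points by blast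
  have "tangent_map (cotangent_bundle A) A fst (q, \<alpha>)
      (coord_vec (cotangent_bundle A) (cotangent_chart A c) (q, \<alpha>) u) = coord_vec A c q (fst u)"
    using tangent_map_coord_vec[OF smooth_atlas_cotangent_bundle[OF A(1)] A(1)
        smooth_map_on_cotangent_projection[OF A(1)] P C A(2)] q \<alpha>
      fderiv_local_rep_cotangent_projection[OF A x, of \<xi>] by simp
  then show ?thesis
    using covec_coords_inner[OF A q(1) cotangent_spaceD[OF \<alpha>(1)], of "fst u"] \<alpha>(2)
    unfolding form1_coeff_def inv canonical_form1_def by simp
qed

lemma smooth_form1_canonical_form1:
  fixes A :: "('m, 'e::euclidean_space) atlas"
  assumes A: "smooth_atlas A"
  shows "smooth_form1 (cotangent_bundle A) (canonical_form1 A)"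
proof (rule smooth_form1I)
  fix P assume P: "P \<in> points (cotangent_bundle A)"
  have lin: "linear_on_tangent A (fst P) (snd P)"
    using P cotangent_spaceD by (auto simp: points_cotangent_bundle)
  note TA = smooth_atlas_cotangent_bundle[OF A] and pr = smooth_map_on_cotangent_projection[OF A]
  have [simp]: "canonical_form1 A P \<Xi> = snd P (tangent_map (cotangent_bundle A) A fst P \<Xi>)" for \<Xi>
    by (simp add: canonical_form1_def split: prod.split)
  show "linear_on_tangent (cotangent_bundle A) P (canonical_form1 A P)"
    by (rule linear_on_tangentI)
       (simp_all add: tangent_map_linear[OF TA pr P P] linear_on_tangentD[OF lin]
        tangent_map_in_tangent_space[OF TA A pr P P])
next
  fix C u assume "C \<in> cotangent_bundle A"
  then obtain c where C: "C = cotangent_chart A c" and c: "c \<in> A"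
    unfolding in_cotangent_bundle_iff by blast
  let ?S = "chart_map c ` chart_dom c" and ?U = "UNIV :: 'e set"
  have img: "chart_map C ` chart_dom C = ?S \<times> ?U"
    using cotangent_chart_image[OF A c order_refl] by (simp only: C chart_dom_cotangent_chart)
  have SU: "open (?S \<times> ?U)" using open_chart_image[OF A c] by (simp add: open_Times)
  show "smooth_on (chart_map C ` chart_dom C) (form1_coeff (cotangent_bundle A) (canonical_form1 A) C u)"
    unfolding img
  proof (rule smooth_on_eq[OF SU smooth_on_inner[OF SU smooth_on_const
          smooth_on_bounded_linear[OF SU bounded_linear_snd smooth_on_ident]]])
    fix z assume "z \<in> ?S \<times> ?U"
    then have "fst z \<in> ?S" by auto
    from form1_coeff_canonical_form1[OF A c this, of u "snd z"]
    show "form1_coeff (cotangent_bundle A) (canonical_form1 A) C u z = fst u \<bullet> snd z"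
      by (simp add: C)
  qed
qed

section \<open>One-forms on a product along the second factor\<close>

text \<open>The one-form with the values \<open>\<alpha> (0, v\<^sub>2)\<close> on tangent vectors \<open>(v\<^sub>1, v\<^sub>2)\<close> of the product.\<close>

definition snd_part ::
    "('m, 'e::euclidean_space) atlas \<Rightarrow> ('n, 'f::euclidean_space) atlas
      \<Rightarrow> ('m \<times> 'n, 'e \<times> 'f) form1 \<Rightarrow> ('m \<times> 'n, 'e \<times> 'f) form1" where
  "snd_part A B \<alpha> = (\<lambda>p v. \<alpha> p (tpair A B (fst p) (snd p) tzero (tangent_map (prod_atlas A B) B snd p v)))"

text \<open>The same data as a map into the cotangent bundle of the second factor. The covector is made
  extensional, as points of the bundle are.\<close>

definition snd_covector ::
    "('m, 'e::euclidean_space) atlas \<Rightarrow> ('n, 'f::euclidean_space) atlas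
      \<Rightarrow> ('m \<times> 'n, 'e \<times> 'f) form1 \<Rightarrow> 'm \<times> 'n \<Rightarrow> 'n \<times> ('n, 'f) covec" where
  "snd_covector A B \<alpha> = (\<lambda>p. (snd p, \<lambda>v\<in>tangent_space B (snd p). \<alpha> p (tpair A B (fst p) (snd p) tzero v)))"

lemma tadd_tzero [simp]: "tadd tzero v = v" "tadd v tzero = v" "tscale r tzero = tzero"
  by (simp_all add: tadd_def tzero_def tscale_def)

lemma linear_on_second_factor:
  assumes A: "smooth_atlas A" and B: "smooth_atlas B" and \<alpha>: "smooth_form1 (prod_atlas A B) \<alpha>"
    and p: "p \<in> points (prod_atlas A B)"
  shows "linear_on_tangent B (snd p) (\<lambda>v. \<alpha> p (tpair A B (fst p) (snd p) tzero v))"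
proof -
  have p': "fst p \<in> points A" "snd p \<in> points B" using p by (auto simp: points_prod_atlas)
  note lin = linear_on_tangentD[OF smooth_form1_linear[OF \<alpha> p]]
  note z = tzero_in_tangent_space[OF A, of "fst p"]
  show ?thesis
    using tpair_tadd[OF A p'(1) B p'(2) z z] tpair_tscale[OF A p'(1) B p'(2) z]
      tpair_in_tangent_space[OF A p'(1) B p'(2) z] lin
    by (intro linear_on_tangentI) simp_all
qed

lemma tpair_tzero_coord_vec:
  assumes A: "smooth_atlas A" "c \<in> A" "p \<in> chart_dom c" and B: "smooth_atlas B" "d \<in> B" "q \<in> chart_dom d"
  shows "tpair A B p q tzero (coord_vec B d q u) = coord_vec (prod_atlas A B) (prod_chart c d) (p, q) (0, u)"
  using tpair_eq_coord_vec[OF A B tzero_in_tangent_space[OF A(1)] coord_vec_in_tangent_space[OF B]]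
  by (simp add: coord_vec_same[OF B]) (simp add: tzero_def)

text \<open>In a product chart the coefficient of the second-factor part in direction \<open>u\<close> is the coefficient
  of the whole form in direction \<open>(0, u\<^sub>2)\<close>.\<close>

lemma smooth_form1_snd_part:
  fixes A :: "('m, 'e::euclidean_space) atlas" and B :: "('n, 'f::euclidean_space) atlas"
  assumes A: "smooth_atlas A" and B: "smooth_atlas B" and \<alpha>: "smooth_form1 (prod_atlas A B) \<alpha>"
  shows "smooth_form1 (prod_atlas A B) (snd_part A B \<alpha>)"
proof (rule smooth_form1I)
  note M = smooth_atlas_prod_atlas[OF A B]
  {
    fix p assume p: "p \<in> points (prod_atlas A B)"
    note lin = linear_on_tangentD[OF linear_on_second_factor[OF A B \<alpha> p]]
    show "linear_on_tangent (prod_atlas A B) p (snd_part A B \<alpha> p)"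
      unfolding snd_part_def
      using tangent_map_linear[OF M smooth_map_on_snd[OF A B] p p]
        tangent_map_proj_in_tangent_space(2)[OF A B p] lin
      by (intro linear_on_tangentI) simp_all
  }
  fix e u assume e': "e \<in> prod_atlas A B"
  then obtain c d where e: "e = prod_chart c d" and c: "c \<in> A" and d: "d \<in> B"
    unfolding in_prod_atlas_iff by blast
  show "smooth_on (chart_map e ` chart_dom e) (form1_coeff (prod_atlas A B) (snd_part A B \<alpha>) e u)"
  proof (rule smooth_on_eq[OF open_chart_image[OF M e'] smooth_form1_coeff[OF \<alpha> e']])
    fix x assume "x \<in> chart_map e ` chart_dom e"
    then obtain p q where p: "p \<in> chart_dom c" and q: "q \<in> chart_dom d"
      and x: "x = (chart_map c p, chart_map d q)" by (auto simp: e)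
    have inv: "chart_inv e x = (p, q)"
      using chart_inv_map[OF M e', of "(p, q)"] p q by (simp add: e x)
    have pq: "(p, q) \<in> chart_dom e" using p q by (simp add: e)
    then have pqM: "(p, q) \<in> points (prod_atlas A B)" using e' chart_dom_subset_points by blast
    have "tangent_map (prod_atlas A B) B snd (p, q) (coord_vec (prod_atlas A B) e (p, q) u)
        = coord_vec B d q (snd u)"
      using tangent_map_coord_vec[OF M B smooth_map_on_snd[OF A B] pqM e' pq d, of u] q p
        fderiv_local_rep_proj(2)[OF A c B d, of "chart_map c p" "chart_map d q"] by (simp add: e)
    then show "form1_coeff (prod_atlas A B) (snd_part A B \<alpha>) e u x
        = form1_coeff (prod_atlas A B) \<alpha> e (0, snd u) x"
      using tpair_tzero_coord_vec[OF A c p B d q]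
      by (simp add: form1_coeff_def snd_part_def inv) (simp add: e)
  qed
qed

text \<open>The chart \<open>d'\<close> of the second factor that gives the bundle chart need not be the chart \<open>d\<close> in which
  the point is read. The coordinates of the covector are coefficients of \<open>\<alpha>\<close> in the product chart of
  \<open>c\<close> and \<open>d'\<close>, so the coordinate change from \<open>d\<close> to \<open>d'\<close> is composed in front.\<close>

lemma smooth_map_on_snd_covector:
  fixes A :: "('m, 'e::euclidean_space) atlas" and B :: "('n, 'f::euclidean_space) atlas"
  assumes A: "smooth_atlas A" and B: "smooth_atlas B" and \<alpha>: "smooth_form1 (prod_atlas A B) \<alpha>"
  shows "smooth_map_on (prod_atlas A B) (cotangent_bundle B) (points (prod_atlas A B)) (snd_covector A B \<alpha>)"
  unfolding smooth_map_on_def Let_def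
proof (intro conjI ballI)
  note M = smooth_atlas_prod_atlas[OF A B]
  let ?M = "prod_atlas A B" and ?\<Phi> = "snd_covector A B \<alpha>"
  have cov: "snd (?\<Phi> p) \<in> cotangent_space B (snd p)" if "p \<in> points ?M" for p
  proof -
    have "linear_on_tangent B (snd p) (snd (?\<Phi> p))"
      using linear_on_second_factor[OF A B \<alpha> that] tadd_in_tangent_space[OF B] tscale_in_tangent_space[OF B]
      by (simp add: snd_covector_def linear_on_tangent_def)
    then show ?thesis by (simp add: cotangent_space_def snd_covector_def)
  qed
  have fst_\<Phi>: "fst (?\<Phi> p) = snd p" for p by (simp add: snd_covector_def)
  show "?\<Phi> ` points ?M \<subseteq> points (cotangent_bundle B)"
  proof (rule image_subsetI)
    fix p assume p: "p \<in> points ?M"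
    have "(snd p, snd (?\<Phi> p)) \<in> points (cotangent_bundle B)"
      using cov[OF p] p by (auto simp: points_cotangent_bundle points_prod_atlas)
    then show "?\<Phi> p \<in> points (cotangent_bundle B)" using fst_\<Phi>[of p] by (metis prod.collapse)
  qed
  fix e D assume e': "e \<in> ?M" and "D \<in> cotangent_bundle B"
  then obtain c d d' where e: "e = prod_chart c d" and D: "D = cotangent_chart B d'"
    and c: "c \<in> A" and d: "d \<in> B" and d': "d' \<in> B"
    unfolding in_prod_atlas_iff in_cotangent_bundle_iff by blast
  let ?S = "chart_map c ` chart_dom c" and ?T = "chart_map d ` (chart_dom d \<inter> chart_dom d')"
    and ?T' = "chart_map d' ` chart_dom d'" and ?t = "chart_map d' \<circ> chart_inv d"
  have S: "open ?S" and T: "open ?T" and T': "open ?T'"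
    using open_chart_image[OF A c] open_chart_overlap[OF B d d'] open_chart_image[OF B d'] by auto
  note ST = open_Times[OF S T]
  have "p \<in> chart_dom e \<inter> points ?M \<and> ?\<Phi> p \<in> chart_dom D \<longleftrightarrow> p \<in> chart_dom c \<times> (chart_dom d \<inter> chart_dom d')" for p
  proof -
    have "p \<in> chart_dom e \<Longrightarrow> p \<in> points ?M" using e' chart_dom_subset_points by blast
    moreover have "?\<Phi> p \<in> chart_dom D \<longleftrightarrow> snd p \<in> chart_dom d' \<and> snd (?\<Phi> p) \<in> cotangent_space B (snd p)"
      by (simp add: D mem_Sigma_iff[of "fst (?\<Phi> p)" "snd (?\<Phi> p)", simplified] fst_\<Phi>)
    ultimately show ?thesis using cov[of p] by (auto simp: e mem_Times_iff)
  qed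
  then have "{p \<in> chart_dom e \<inter> points ?M. ?\<Phi> p \<in> chart_dom D} = chart_dom c \<times> (chart_dom d \<inter> chart_dom d')"
    by blast
  then have img: "chart_map e ` {p \<in> chart_dom e \<inter> points ?M. ?\<Phi> p \<in> chart_dom D} = ?S \<times> ?T"
    by (simp add: e map_prod_image_Times)
  show "open (chart_map e ` {p \<in> chart_dom e \<inter> points ?M. ?\<Phi> p \<in> chart_dom D})"
    unfolding img by (rule ST)
  let ?r = "\<lambda>x. (fst x, ?t (snd x))" and ?a = "\<lambda>b. form1_coeff ?M \<alpha> (prod_chart c d') (0, b)"
  have t: "smooth_on (?S \<times> ?T) (\<lambda>x. ?t (snd x))"
    by (rule smooth_on_snd[OF S T smooth_transition[OF B d d']])
  have r: "smooth_on (?S \<times> ?T) ?r"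
    by (rule smooth_on_Pair[OF ST smooth_on_bounded_linear[OF ST bounded_linear_fst smooth_on_ident] t])
  have "smooth_on (?S \<times> ?T') (?a b)" for b
    using smooth_form1_coeff[OF \<alpha> prod_chart_in_prod_atlas[OF c d']] by (simp add: map_prod_image_Times)
  moreover have "?r ` (?S \<times> ?T) \<subseteq> ?S \<times> ?T'" using chart_inv_map[OF B d] by auto
  ultimately have a: "smooth_on (?S \<times> ?T) (\<lambda>x. ?a b (?r x))" for b
    using smooth_on_compose[OF ST open_Times[OF S T'] _ r] by blast
  have rep: "smooth_on (?S \<times> ?T) (\<lambda>x. (?t (snd x), \<Sum>b\<in>Basis. ?a b (?r x) *\<^sub>R b))"
    by (rule smooth_on_Pair[OF ST t], rule smooth_on_sum[OF ST], rule smooth_on_scaleR[OF ST a smooth_on_const])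
  show "smooth_on (chart_map e ` {p \<in> chart_dom e \<inter> points ?M. ?\<Phi> p \<in> chart_dom D}) (chart_map D \<circ> ?\<Phi> \<circ> chart_inv e)"
    unfolding img
  proof (rule smooth_on_eq[OF ST rep])
    fix x assume "x \<in> ?S \<times> ?T"
    then obtain p q where p: "p \<in> chart_dom c" and q: "q \<in> chart_dom d" "q \<in> chart_dom d'"
      and x: "x = (chart_map c p, chart_map d q)" by auto
    have inv: "chart_inv e x = (p, q)"
      using chart_inv_map[OF M e', of "(p, q)"] p q by (simp add: e x)
    have inv': "chart_inv (prod_chart c d') (chart_map c p, chart_map d' q) = (p, q)"
      using chart_inv_map[OF M prod_chart_in_prod_atlas[OF c d'], of "(p, q)"] p q by simp
    have "snd (?\<Phi> (p, q)) (coord_vec B d' q b) = ?a b (chart_map c p, chart_map d' q)" for b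
      using tpair_tzero_coord_vec[OF A c p B d' q(2)] coord_vec_in_tangent_space[OF B d' q(2)]
      unfolding form1_coeff_def inv' by (simp add: snd_covector_def)
    then have "covec_coords B d' q (snd (?\<Phi> (p, q))) = (\<Sum>b\<in>Basis. ?a b (chart_map c p, chart_map d' q) *\<^sub>R b)"
      by (simp add: covec_coords_def)
    then show "(chart_map D \<circ> ?\<Phi> \<circ> chart_inv e) x = (?t (snd x), \<Sum>b\<in>Basis. ?a b (?r x) *\<^sub>R b)"
      using chart_inv_map[OF B d q(1)] fst_\<Phi>[of "(p, q)"]
      by (simp add: inv D case_prod_beta) (simp add: x)
  qed
qed

text \<open>The tautological property of the canonical one-form: at a point that is a covector, it applies that
  covector to the projection of the tangent vector to the base. Here the projection to the base is
  the second projection of the product.\<close>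

lemma pullback_canonical_form1_snd_covector:
  fixes A :: "('m, 'e::euclidean_space) atlas" and B :: "('n, 'f::euclidean_space) atlas"
  assumes A: "smooth_atlas A" and B: "smooth_atlas B" and \<alpha>: "smooth_form1 (prod_atlas A B) \<alpha>"
    and p: "p \<in> points (prod_atlas A B)" and v: "v \<in> tangent_space (prod_atlas A B) p"
  shows "tangent_map (cotangent_bundle B) B fst (snd_covector A B \<alpha> p)
      (tangent_map (prod_atlas A B) (cotangent_bundle B) (snd_covector A B \<alpha>) p v)
      = tangent_map (prod_atlas A B) B snd p v"
    and "pullback1 (prod_atlas A B) (cotangent_bundle B) (snd_covector A B \<alpha>) (canonical_form1 B) p v
      = snd_part A B \<alpha> p v"
proof -
  note \<Phi> = smooth_map_on_snd_covector[OF A B \<alpha>]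
  have \<Phi>p: "snd_covector A B \<alpha> p \<in> points (cotangent_bundle B)"
    using \<Phi> p unfolding smooth_map_on_def by blast
  show 1: "tangent_map (cotangent_bundle B) B fst (snd_covector A B \<alpha> p)
      (tangent_map (prod_atlas A B) (cotangent_bundle B) (snd_covector A B \<alpha>) p v)
      = tangent_map (prod_atlas A B) B snd p v"
    by (rule tangent_map_comp[OF smooth_atlas_prod_atlas[OF A B] smooth_atlas_cotangent_bundle[OF B]
          \<Phi> smooth_map_on_cotangent_projection[OF B] _ p p \<Phi>p \<Phi>p v, symmetric])
       (simp add: snd_covector_def)
  have "pullback1 (prod_atlas A B) (cotangent_bundle B) (snd_covector A B \<alpha>) (canonical_form1 B) p v
      = snd (snd_covector A B \<alpha> p) (tangent_map (cotangent_bundle B) B fst (snd_covector A B \<alpha> p)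
      (tangent_map (prod_atlas A B) (cotangent_bundle B) (snd_covector A B \<alpha>) p v))"
    by (simp add: pullback1_def canonical_form1_def case_prod_beta)
  then show "pullback1 (prod_atlas A B) (cotangent_bundle B) (snd_covector A B \<alpha>) (canonical_form1 B) p v
      = snd_part A B \<alpha> p v"
    unfolding 1 using tangent_map_proj_in_tangent_space(2)[OF A B p v]
    by (simp add: snd_covector_def snd_part_def)
qed

section \<open>Discrete mechanical systems\<close>

text \<open>The Lagrangian and the force enter the trajectories and the Legendre transform only through this
  sum.\<close>

definition forced_differential ::
    "('q, 'e::euclidean_space) atlas \<Rightarrow> ('q \<times> 'q \<Rightarrow> real) \<Rightarrow> ('q \<times> 'q, 'e \<times> 'e) form1
      \<Rightarrow> ('q \<times> 'q, 'e \<times> 'e) form1" where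
  "forced_differential Q L f = (\<lambda>p v. differential (prod_atlas Q Q) L p v + f p v)"

lemma legendre_plus_eq_snd_covector: "legendre_plus Q L f = snd_covector Q Q (forced_differential Q L f)"
  by (auto simp: legendre_plus_def snd_covector_def forced_differential_def D2_def force_plus_def)

lemma trajectory_iff_forced_differential:
  "trajectory Q L f q0 q1 q2 \<longleftrightarrow> q0 \<in> points Q \<and> q1 \<in> points Q \<and> q2 \<in> points Q \<and>
    (\<forall>v\<in>tangent_space Q q1. forced_differential Q L f (q0, q1) (tpair Q Q q0 q1 tzero v)
      + forced_differential Q L f (q1, q2) (tpair Q Q q1 q2 v tzero) = 0)"
  unfolding trajectory_def forced_differential_def D1_def D2_def force_plus_def force_minus_def
  by (auto simp: algebra_simps)

lemma omega_plus_eq: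
  fixes Q :: "('q, 'e::euclidean_space) atlas"
  assumes Q: "smooth_atlas Q" and \<alpha>: "smooth_form1 (prod_atlas Q Q) (forced_differential Q L f)"
    and p: "p \<in> points (prod_atlas Q Q)"
    and v: "v \<in> tangent_space (prod_atlas Q Q) p" and w: "w \<in> tangent_space (prod_atlas Q Q) p"
  shows "omega_plus Q L f \<beta> p v w =
    - ext_deriv (prod_atlas Q Q) (snd_part Q Q (forced_differential Q L f)) p v w
    - pullback2 (prod_atlas Q Q) Q snd \<beta> p v w"
proof -
  let ?M = "prod_atlas Q Q" and ?T = "cotangent_bundle Q" and ?\<alpha> = "forced_differential Q L f"
  let ?\<Phi> = "snd_covector Q Q ?\<alpha>"
  note M = smooth_atlas_prod_atlas[OF Q Q]
  have "ext_deriv ?T (canonical_form1 Q) (?\<Phi> p) (tangent_map ?M ?T ?\<Phi> p v) (tangent_map ?M ?T ?\<Phi> p w)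
      = ext_deriv ?M (pullback1 ?M ?T ?\<Phi> (canonical_form1 Q)) p v w"
    by (rule ext_deriv_pullback1[OF M smooth_atlas_cotangent_bundle[OF Q]
          smooth_map_on_snd_covector[OF Q Q \<alpha>] p p smooth_form1_canonical_form1[OF Q], symmetric])
  also have "\<dots> = ext_deriv ?M (snd_part Q Q ?\<alpha>) p v w"
    by (rule ext_deriv_cong[OF M atlas_open_points[OF M] p smooth_form1_snd_part[OF Q Q \<alpha>], symmetric])
       (rule pullback_canonical_form1_snd_covector(2)[OF Q Q \<alpha>, symmetric])
  finally show ?thesis
    using pullback_canonical_form1_snd_covector(1)[OF Q Q \<alpha> p] v w
    by (simp add: omega_plus_def pullback2_def form2_minus_def canonical_symplectic_def form2_uminus_def
        legendre_plus_eq_snd_covector) (simp add: snd_covector_def)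
qed

theorem proposition2p25:
  fixes Q :: "('q, real ^ 'n) atlas"
    and L :: "'q \<times> 'q \<Rightarrow> real"
    and f :: "('q \<times> 'q, (real ^ 'n) \<times> (real ^ 'n)) form1"
    and \<beta> :: "('q, real ^ 'n) form2"
    and F :: "'q \<times> 'q \<Rightarrow> 'q \<times> 'q"
    and U V :: "('q \<times> 'q) set"
  assumes "forced_discrete_system Q L f"
    and "routh_type Q f \<beta>"
    and "forced_discrete_flow Q L f F U V"
  shows "form2_eq_on (prod_atlas Q Q) U
           (pullback2 (prod_atlas Q Q) (prod_atlas Q Q) F (omega_plus Q L f \<beta>))
           (omega_plus Q L f \<beta>)"
  unfolding form2_eq_on_def
proof (intro ballI)
  let ?M = "prod_atlas Q Q"
  define \<alpha> where "\<alpha> = forced_differential Q L f"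
  define \<sigma> where "\<sigma> = snd_part Q Q \<alpha>"
  define \<tau> where "\<tau> = (\<lambda>p v. (\<sigma> p v - differential ?M L p v) - f p v)"
  have Q: "smooth_atlas Q" and L: "smooth_function ?M L" and f: "smooth_form1 ?M f"
    using assms(1) unfolding forced_discrete_system_def smooth_manifold_def by auto
  have M: "smooth_atlas ?M" by (rule smooth_atlas_prod_atlas[OF Q Q])
  have dL: "smooth_form1 ?M (differential ?M L)" by (rule smooth_form1_differential[OF M L])
  have \<alpha>: "smooth_form1 ?M \<alpha>"
    unfolding \<alpha>_def forced_differential_def by (rule smooth_form1_add[OF M dL f])
  have \<sigma>: "smooth_form1 ?M \<sigma>" unfolding \<sigma>_def by (rule smooth_form1_snd_part[OF Q Q \<alpha>])
  have \<tau>: "smooth_form1 ?M \<tau>"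
    unfolding \<tau>_def by (rule smooth_form1_diff[OF M smooth_form1_diff[OF M \<sigma> dL] f])
  have U: "atlas_open ?M U"
    using assms(3) openin_atlas_topology[OF M] unfolding forced_discrete_flow_def by blast
  have UM: "U \<subseteq> points ?M" using U unfolding atlas_open_def by blast
  have F: "smooth_map_on ?M ?M U F"
    using assms(3) unfolding forced_discrete_flow_def diffeomorphism_between_def by blast
  have FM: "F p \<in> points ?M" if "p \<in> U" for p using F that unfolding smooth_map_on_def by blast
  have flow: "\<exists>q2. F p = (snd p, q2) \<and> trajectory Q L f (fst p) (snd p) q2" if "p \<in> U" for p
    using assms(3) that unfolding forced_discrete_flow_def by (metis prod.collapse)
  have fstF: "fst (F p) = snd p" if "p \<in> U" for p using flow[OF that] by auto
  have TF: "tangent_map ?M ?M F p v \<in> tangent_space ?M (F p)"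
    if "p \<in> U" "v \<in> tangent_space ?M p" for p v
    using tangent_map_in_tangent_space[OF M M F that(1) _ that(2)] UM that by blast
  have TfstF: "tangent_map ?M Q fst (F p) (tangent_map ?M ?M F p v) = tangent_map ?M Q snd p v"
    if "p \<in> U" "v \<in> tangent_space ?M p" for p v
    using tangent_map_comp[OF M M F smooth_map_on_fst[OF Q Q], of snd p v] fstF that UM FM by auto
  \<comment> \<open>The trajectory equation as an identity between one-forms on the domain of the flow.\<close>
  have pull: "pullback1 ?M ?M F \<tau> p v = \<sigma> p v" if p: "p \<in> U" and v: "v \<in> tangent_space ?M p" for p v
  proof -
    let ?V = "tangent_map ?M ?M F p v"
    define x where "x = tangent_map ?M Q snd p v"
    define y where "y = tangent_map ?M Q snd (F p) ?V"
    have pM: "p \<in> points ?M" using p UM by blast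
    obtain q2 where q2: "F p = (snd p, q2)" "trajectory Q L f (fst p) (snd p) q2" using flow[OF p] by blast
    have pts: "snd p \<in> points Q" "q2 \<in> points Q" using FM[OF p] q2(1) by (auto simp: points_prod_atlas)
    have x: "x \<in> tangent_space Q (snd p)"
      unfolding x_def by (rule tangent_map_proj_in_tangent_space(2)[OF Q Q pM v])
    have y: "y \<in> tangent_space Q q2"
      using tangent_map_proj_in_tangent_space(2)[OF Q Q FM[OF p] TF[OF p v]] q2(1) by (simp add: y_def)
    note z = tzero_in_tangent_space[OF Q]
    \<comment> \<open>The image \<open>?V\<close> of \<open>v\<close> has first component \<open>x\<close>, the second component of \<open>v\<close>; its second
      component \<open>y\<close> drops out of \<open>\<tau>\<close>.\<close>
    have "tpair Q Q (snd p) q2 x y = ?V"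
      using tpair_tangent_map_proj[OF Q Q FM[OF p] TF[OF p v]] TfstF[OF p v] q2(1)
      by (simp add: x_def y_def)
    then have V: "?V = tadd (tpair Q Q (snd p) q2 x tzero) (tpair Q Q (snd p) q2 tzero y)"
      using tpair_tadd[OF Q pts(1) Q pts(2) x z z y] by simp
    have "\<alpha> (F p) ?V = \<alpha> (F p) (tpair Q Q (snd p) q2 x tzero) + \<alpha> (F p) (tpair Q Q (snd p) q2 tzero y)"
      using linear_on_tangentD(1)[OF smooth_form1_linear[OF \<alpha> FM[OF p]],
          of "tpair Q Q (snd p) q2 x tzero" "tpair Q Q (snd p) q2 tzero y"]
        tpair_in_tangent_space[OF Q pts(1) Q pts(2) x z] tpair_in_tangent_space[OF Q pts(1) Q pts(2) z y]
      by (simp add: V q2(1))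
    moreover have "\<sigma> (F p) ?V = \<alpha> (F p) (tpair Q Q (snd p) q2 tzero y)"
      by (simp add: \<sigma>_def snd_part_def y_def q2(1))
    ultimately have "\<tau> (F p) ?V = - \<alpha> (F p) (tpair Q Q (snd p) q2 x tzero)"
      by (simp add: \<tau>_def \<alpha>_def forced_differential_def)
    also have "\<dots> = \<alpha> p (tpair Q Q (fst p) (snd p) tzero x)"
    proof -
      have "\<alpha> p (tpair Q Q (fst p) (snd p) tzero x) + \<alpha> (F p) (tpair Q Q (snd p) q2 x tzero) = 0"
        using q2 x unfolding trajectory_iff_forced_differential \<alpha>_def by simp
      then show ?thesis by linarith
    qed
    also have "\<dots> = \<sigma> p v" by (simp add: \<sigma>_def snd_part_def x_def)
    finally show ?thesis by (simp add: pullback1_def)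
  qed
  fix p v w assume p: "p \<in> U" and v: "v \<in> tangent_space ?M p" and w: "w \<in> tangent_space ?M p"
  let ?V = "tangent_map ?M ?M F p v" and ?W = "tangent_map ?M ?M F p w"
  have pM: "p \<in> points ?M" using p UM by blast
  have d\<sigma>: "ext_deriv ?M \<sigma> p v w = ext_deriv ?M \<tau> (F p) ?V ?W"
    using ext_deriv_cong[OF M U p \<sigma>, of "pullback1 ?M ?M F \<tau>"] pull
      ext_deriv_pullback1[OF M M F p pM \<tau>] by simp
  have d\<tau>: "ext_deriv ?M \<tau> (F p) ?V ?W = ext_deriv ?M \<sigma> (F p) ?V ?W - ext_deriv ?M f (F p) ?V ?W"
    unfolding \<tau>_def using ext_deriv_diff[OF FM[OF p] smooth_form1_diff[OF M \<sigma> dL] f]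
      ext_deriv_diff[OF FM[OF p] \<sigma> dL] ext_deriv_differential[OF M L FM[OF p]] by simp
  have df: "- ext_deriv ?M f (F p) ?V ?W
      = pullback2 ?M Q snd \<beta> (F p) ?V ?W - pullback2 ?M Q fst \<beta> (F p) ?V ?W"
    using assms(2) FM[OF p] TF[OF p v] TF[OF p w]
    unfolding routh_type_def form2_eq_on_def form2_uminus_def form2_minus_def by blast
  have pr: "pullback2 ?M Q fst \<beta> (F p) ?V ?W = pullback2 ?M Q snd \<beta> p v w"
    using TfstF[OF p v] TfstF[OF p w] fstF[OF p] by (simp add: pullback2_def)
  have "omega_plus Q L f \<beta> (F p) ?V ?W = - ext_deriv ?M \<sigma> (F p) ?V ?W - pullback2 ?M Q snd \<beta> (F p) ?V ?W"
    using omega_plus_eq[OF Q _ FM[OF p] TF[OF p v] TF[OF p w]] \<alpha> by (simp add: \<alpha>_def \<sigma>_def)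
  also have "\<dots> = - ext_deriv ?M \<sigma> p v w - pullback2 ?M Q snd \<beta> p v w"
    using d\<sigma> d\<tau> df pr by simp
  also have "\<dots> = omega_plus Q L f \<beta> p v w"
    using omega_plus_eq[OF Q _ pM v w] \<alpha> by (simp add: \<alpha>_def \<sigma>_def)
  finally show "pullback2 ?M ?M F (omega_plus Q L f \<beta>) p v w = omega_plus Q L f \<beta> p v w"
    by (simp add: pullback2_def)
qed

end
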